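(* Let $m<\infty$, let $\boldsymbol{\lambda}\in\mathcal{P}(d,m,n)$, and let $V_{\boldsymbol{\lambda}}$ be the $\mathcal{F}_m$-vector space with basis $\{\mathbf{v}_{\mathcal{T}}\}$ indexed by the standard $(d,m)$-tableaux $\mathcal{T}$ of shape $\boldsymbol{\lambda}$; set $\mathbf{v}_{\mathcal{T}}:=0$ for any non-standard $(d,m)$-tableau $\mathcal{T}$ of shape $\boldsymbol{\lambda}$. For a standard $(d,m)$-tableau $\mathcal{T}$ of shape $\boldsymbol{\lambda}$ set $\mathrm{p}_i:=\mathrm{p}^{(d)}(\mathcal{T}|i)$ and $\mathrm{c}_i:=\mathrm{c}(\mathcal{T}|i)$ for $i=1,\ldots,n$. Then $V_{\boldsymbol{\lambda}}$ is a representation of $\mathcal{F}_m\mathrm{Y}(d,m,n)$ with the action of the generators on the basis elements $\mathbf{v}_{\mathcal{T}}$ ($\mathcal{T}$ standard of shape $\boldsymbol\lambda$) defined as follows: $$X_1(\mathbf{v}_{\mathcal{T}})=\mathrm{c}_1\mathbf{v}_{\mathcal{T}};$$ for $j=1,\ldots,n$, $$t_j(\mathbf{v}_{\mathcal{T}})=\xi_{\mathrm{p}_j}\mathbf{v}_{\mathcal{T}};$$ for $i=1,\ldots,n-1$, if $\mathrm{p}_i\neq \mathrm{p}_{i+1}$ then $$g_i(\mathbf{v}_{\mathcal{T}})=\mathbf{v}_{\mathcal{T}^{s_i}},$$ and if $\mathrm{p}_i=\mathrm{p}_{i+1}$ then $$g_i(\mathbf{v}_{\mathcal{T}})=\frac{\mathrm{c}_{i+1}(q-q^{-1})}{\mathrm{c}_{i+1}-\mathrm{c}_i}\,\mathbf{v}_{\mathcal{T}}+\frac{q\mathrm{c}_{i+1}-q^{-1}\mathrm{c}_i}{\mathrm{c}_{i+1}-\mathrm{c}_i}\,\mathbf{v}_{\mathcal{T}^{s_i}},$$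 where $s_i$ is the transposition $(i,i+1)$.
   Context: Algebra. Let $d,n,m\in\mathbb{Z}_{>0}$. Let $q,v_1,\ldots,v_m$ be indeterminates, $\mathcal{R}_m:=\mathbb{C}[q^{\pm1},v_1^{\pm1},\ldots,v_m^{\pm1}]$, and $\mathcal{F}_m$ its field of fractions. The cyclotomic Yokonuma--Hecke algebra $\mathrm{Y}(d,m,n)$ is the associative $\mathcal{R}_m$-algebra generated by $t_1,\ldots,t_n,g_1,\ldots,g_{n-1},X_1^{\pm1}$ with relations: $g_ig_j=g_jg_i$ if $|i-j|>1$; $g_ig_{i+1}g_i=g_{i+1}g_ig_{i+1}$; $t_it_j=t_jt_i$; $t_jg_i=g_it_{s_i(j)}$ with $s_i=(i,i+1)$; $t_j^d=1$; $g_i^2=1+(q-q^{-1})e_ig_i$ with $e_i:=\frac1d\sum_{s=0}^{d-1}t_i^st_{i+1}^{-s}$; $X_1g_1X_1g_1=g_1X_1g_1X_1$; $X_1g_i=g_iX_1$ for $i\ge2$; $X_1t_j=t_jX_1$ for all $j$; and $(X_1-v_1)\cdots(X_1-v_m)=0$. Put $\mathcal{F}_m\mathrm{Y}(d,m,n):=\mathcal{F}_m\otimes_{\mathcal{R}_m}\mathrm{Y}(d,m,n)$. Combinatorics. A $(d,m)$-partition of size $n$ is a $d$-tuple of $m$-tuples of partitions (identified with Young diagrams) with $n$ nodes in total; the $l$-th partition of the $k$-th $m$-tuple has position $(k,l)$. $\mathcal{P}(d,m,n)$ is the set of all $(d,m)$-partitions of size $n$. A $(d,m)$-node is a triple $\boldsymbol{\theta}=((x,y),k,l)$,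 consisting of a node in row $x$, column $y$, and a position $(k,l)$, $1\le k\le d$, $1\le l\le m$; set $\mathrm{p}^{(d)}(\boldsymbol\theta):=k$ and $\mathrm{c}(\boldsymbol\theta):=v_lq^{2(y-x)}$ (quantum content). A $(d,m)$-partition is identified with its set of $(d,m)$-nodes. A $(d,m)$-tableau of shape $\boldsymbol\lambda$ is a bijection between $\{1,\ldots,n\}$ and the $(d,m)$-nodes of $\boldsymbol\lambda$; it is standard if its entries increase along rows and down columns of every diagram. $\mathrm{p}^{(d)}(\mathcal{T}|i)$ and $\mathrm{c}(\mathcal{T}|i)$ denote $\mathrm{p}^{(d)}$ and $\mathrm{c}$ of the $(d,m)$-node of $\mathcal{T}$ containing $i$. For $\sigma\in\mathfrak{S}_n$, $\mathcal{T}^\sigma$ is obtained from $\mathcal{T}$ by applying $\sigma$ to its entries. $\{\xi_1,\ldots,\xi_d\}\subset\mathbb{C}$ is the set of all $d$-th roots of unity, ordered arbitrarily. *)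

theory Defs
  imports
    Complex_Main
    "HOL-Library.Poly_Mapping"
    "HOL-Library.FuncSet"
    "HOL-Combinatorics.Transposition"
    "HOL-Computational_Algebra.Fraction_Field"
    "HOL-Algebra.Module"
    "HOL-Algebra.QuotRing"
    "HOL-Algebra.Free_Abelian_Groups"
begin

section \<open>Coefficient rings\<close>

text \<open>
  Laurent polynomials over the complex numbers: an exponent vector maps the index of an
  indeterminate to an integer. Index 0 stands for \<open>q\<close>, index \<open>l \<ge> 1\<close> for \<open>v\<^sub>l\<close>. The type has
  infinitely many indeterminates; those with index above \<open>m\<close> are excluded by carrier sets.
\<close>

type_synonym laurent = "(nat \<Rightarrow>\<^sub>0 int) \<Rightarrow>\<^sub>0 complex"

definition laurent_const :: "complex \<Rightarrow> laurent" where
  "laurent_const z = Poly_Mapping.single 0 z"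

definition indet_powi :: "nat \<Rightarrow> int \<Rightarrow> laurent" where
  "indet_powi l k = Poly_Mapping.single (Poly_Mapping.single l k) 1"

definition ring_on :: "'a::ring_1 set \<Rightarrow> 'a ring" where
  "ring_on A = \<lparr>carrier = A, monoid.mult = (*), one = 1, ring.zero = 0, add = (+)\<rparr>"

definition R_ring :: "nat \<Rightarrow> laurent ring" where
  "R_ring m = ring_on {f. \<forall>e \<in> Poly_Mapping.keys f. Poly_Mapping.keys e \<subseteq> {0..m}}"

definition fract_of :: "laurent \<Rightarrow> laurent fract" where
  "fract_of a = Fract a 1"

definition F_ring :: "nat \<Rightarrow> laurent fract ring" where
  "F_ring m = ring_on {Fract a b | a b. a \<in> carrier (R_ring m) \<and> b \<in> carrier (R_ring m) \<and> b \<noteq> 0}"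

definition qF :: "laurent fract" where
  "qF = fract_of (indet_powi 0 1)"

definition vF :: "nat \<Rightarrow> laurent fract" where
  "vF l = fract_of (indet_powi l 1)"

section \<open>Algebras over a commutative ring\<close>

text \<open>
  An associative unital algebra is stored in a \<^const>\<open>smult\<close>-record: its ring operations
  together with the scalar action.
\<close>

definition alg_hom ::
    "('k, 'x) ring_scheme \<Rightarrow> ('k, 'a, 'y) module_scheme \<Rightarrow> ('k, 'b, 'z) module_scheme \<Rightarrow> ('a \<Rightarrow> 'b) set" where
  "alg_hom K A B =
     {h \<in> ring_hom A B. \<forall>c \<in> carrier K. \<forall>a \<in> carrier A. h (c \<odot>\<^bsub>A\<^esub> a) = c \<odot>\<^bsub>B\<^esub> h a}"

definition quotient_algebra ::
    "('k, 'a, 'y) module_scheme \<Rightarrow> 'a set \<Rightarrow> ('k, 'a set) module" where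
  "quotient_algebra A I =
     ring.extend (A Quot I) (module.fields (\<lambda>c C. \<Union>x\<in>C. I +>\<^bsub>A\<^esub> (c \<odot>\<^bsub>A\<^esub> x)))"

text \<open>
  The free module on a set \<open>S\<close> with coefficients in a subset \<open>C\<close> (the carrier of a subring) of a
  type. The multiplicative fields of the record carry no meaning here.
\<close>

definition free_module :: "'c::ring_1 set \<Rightarrow> 's set \<Rightarrow> ('c, 's \<Rightarrow>\<^sub>0 'c) module" where
  "free_module C S =
     \<lparr>carrier = {f. Poly_Mapping.keys f \<subseteq> S \<and> (\<forall>s. Poly_Mapping.lookup f s \<in> C)},
      monoid.mult = undefined, one = undefined, ring.zero = 0, add = (+),
      smult = (\<lambda>c. Poly_Mapping.map ((*) c))\<rparr>"

definition End_algebra ::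
    "('k, 'x) ring_scheme \<Rightarrow> ('k, 'a, 'y) module_scheme \<Rightarrow> ('k, 'a \<Rightarrow> 'a) module" where
  "End_algebra K M =
     \<lparr>carrier = {\<phi> \<in> carrier M \<rightarrow>\<^sub>E carrier M.
        (\<forall>x \<in> carrier M. \<forall>y \<in> carrier M. \<phi> (x \<oplus>\<^bsub>M\<^esub> y) = \<phi> x \<oplus>\<^bsub>M\<^esub> \<phi> y) \<and>
        (\<forall>c \<in> carrier K. \<forall>x \<in> carrier M. \<phi> (c \<odot>\<^bsub>M\<^esub> x) = c \<odot>\<^bsub>M\<^esub> \<phi> x)},
      monoid.mult = compose (carrier M),
      one = (\<lambda>x \<in> carrier M. x),
      ring.zero = (\<lambda>x \<in> carrier M. \<zero>\<^bsub>M\<^esub>),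
      add = (\<lambda>\<phi> \<psi>. \<lambda>x \<in> carrier M. \<phi> x \<oplus>\<^bsub>M\<^esub> \<psi> x),
      smult = (\<lambda>c \<phi>. \<lambda>x \<in> carrier M. c \<odot>\<^bsub>M\<^esub> \<phi> x)\<rparr>"

definition representations ::
    "('k, 'x) ring_scheme \<Rightarrow> ('k, 'a, 'y) module_scheme \<Rightarrow> ('k, 'b, 'z) module_scheme \<Rightarrow> ('a \<Rightarrow> 'b \<Rightarrow> 'b) set" where
  "representations K A M = alg_hom K A (End_algebra K M)"

subsection \<open>Free algebras\<close>

text \<open>
  Words form a noncommutative monoid, written additively so that the convolution product on
  \<open>'g free_word \<Rightarrow>\<^sub>0 'c\<close> is the product of noncommutative polynomials.
\<close>

datatype 'g free_word = Free_Word (letters: "'g list")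

instantiation free_word :: (type) monoid_add
begin

definition zero_free_word :: "'a free_word" where
  "0 = Free_Word []"

definition plus_free_word :: "'a free_word \<Rightarrow> 'a free_word \<Rightarrow> 'a free_word" where
  "u + w = Free_Word (letters u @ letters w)"

instance
  by standard (simp_all add: zero_free_word_def plus_free_word_def)

end

definition scalar :: "'c::ring_1 \<Rightarrow> 'g free_word \<Rightarrow>\<^sub>0 'c" where
  "scalar c = Poly_Mapping.single 0 c"

definition letter :: "'g \<Rightarrow> 'g free_word \<Rightarrow>\<^sub>0 'c::ring_1" where
  "letter g = Poly_Mapping.single (Free_Word [g]) 1"

definition free_algebra :: "'c::ring_1 set \<Rightarrow> 'g set \<Rightarrow> ('c, 'g free_word \<Rightarrow>\<^sub>0 'c) module" where
  "free_algebra C G =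
     (free_module C {w. set (letters w) \<subseteq> G})\<lparr>monoid.mult := (*), one := 1\<rparr>"

subsection \<open>Extension of scalars\<close>

text \<open>
  For a homomorphism \<open>\<iota>\<close> of commutative rings from \<open>R\<close> to \<open>S\<close> and an \<open>R\<close>-algebra \<open>A\<close>, the tensor
  product of \<open>S\<close> and \<open>A\<close> over \<open>R\<close> is the free abelian group on \<open>S \<times> A\<close> modulo bilinearity and
  balancedness. Componentwise multiplication turns that free abelian group into a ring, in which
  the subgroup generated by the relators is already a two-sided ideal; hence
  \<^const>\<open>genideal\<close> describes the same quotient.
\<close>

definition pretensor ::
    "('s, 'x) ring_scheme \<Rightarrow> ('r, 'a, 'y) module_scheme \<Rightarrow> ('s \<times> 'a \<Rightarrow>\<^sub>0 int) ring" where
  "pretensor S A =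
     \<lparr>carrier = carrier (free_Abelian_group (carrier S \<times> carrier A)),
      monoid.mult = (\<lambda>x y. frag_extend (\<lambda>(s, a). frag_extend (\<lambda>(s', a').
        frag_of (s \<otimes>\<^bsub>S\<^esub> s', a \<otimes>\<^bsub>A\<^esub> a')) y) x),
      one = frag_of (\<one>\<^bsub>S\<^esub>, \<one>\<^bsub>A\<^esub>), ring.zero = 0, add = (+)\<rparr>"

definition tensor_relators ::
    "('r, 'w) ring_scheme \<Rightarrow> ('r \<Rightarrow> 's) \<Rightarrow> ('s, 'x) ring_scheme \<Rightarrow> ('r, 'a, 'y) module_scheme
      \<Rightarrow> ('s \<times> 'a \<Rightarrow>\<^sub>0 int) set" where
  "tensor_relators R \<iota> S A =
     {frag_of (s \<oplus>\<^bsub>S\<^esub> s', a) - frag_of (s, a) - frag_of (s', a) | s s' a.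
        s \<in> carrier S \<and> s' \<in> carrier S \<and> a \<in> carrier A} \<union>
     {frag_of (s, a \<oplus>\<^bsub>A\<^esub> a') - frag_of (s, a) - frag_of (s, a') | s a a'.
        s \<in> carrier S \<and> a \<in> carrier A \<and> a' \<in> carrier A} \<union>
     {frag_of (s \<otimes>\<^bsub>S\<^esub> \<iota> r, a) - frag_of (s, r \<odot>\<^bsub>A\<^esub> a) | s r a.
        s \<in> carrier S \<and> r \<in> carrier R \<and> a \<in> carrier A}"

definition tensor_ideal ::
    "('r, 'w) ring_scheme \<Rightarrow> ('r \<Rightarrow> 's) \<Rightarrow> ('s, 'x) ring_scheme \<Rightarrow> ('r, 'a, 'y) module_scheme
      \<Rightarrow> ('s \<times> 'a \<Rightarrow>\<^sub>0 int) set" where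
  "tensor_ideal R \<iota> S A = genideal (pretensor S A) (tensor_relators R \<iota> S A)"

definition pure_tensor ::
    "('r, 'w) ring_scheme \<Rightarrow> ('r \<Rightarrow> 's) \<Rightarrow> ('s, 'x) ring_scheme \<Rightarrow> ('r, 'a, 'y) module_scheme
      \<Rightarrow> 's \<Rightarrow> 'a \<Rightarrow> ('s \<times> 'a \<Rightarrow>\<^sub>0 int) set" where
  "pure_tensor R \<iota> S A s a = tensor_ideal R \<iota> S A +>\<^bsub>pretensor S A\<^esub> frag_of (s, a)"

definition base_change ::
    "('r, 'w) ring_scheme \<Rightarrow> ('r \<Rightarrow> 's) \<Rightarrow> ('s, 'x) ring_scheme \<Rightarrow> ('r, 'a, 'y) module_scheme
      \<Rightarrow> ('s, ('s \<times> 'a \<Rightarrow>\<^sub>0 int) set) module" where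
  "base_change R \<iota> S A =
     (let T = pretensor S A Quot tensor_ideal R \<iota> S A in
      ring.extend T (module.fields
        (\<lambda>s x. pure_tensor R \<iota> S A s \<one>\<^bsub>A\<^esub> \<otimes>\<^bsub>T\<^esub> x)))"

section \<open>The cyclotomic Yokonuma--Hecke algebra\<close>

datatype gen = gen_t nat | gen_g nat | gen_X | gen_X_inv

abbreviation tt :: "nat \<Rightarrow> gen free_word \<Rightarrow>\<^sub>0 laurent" where
  "tt j \<equiv> letter (gen_t j)"

abbreviation gg :: "nat \<Rightarrow> gen free_word \<Rightarrow>\<^sub>0 laurent" where
  "gg i \<equiv> letter (gen_g i)"

abbreviation XX :: "gen free_word \<Rightarrow>\<^sub>0 laurent" where
  "XX \<equiv> letter gen_X"

abbreviation XX_inv :: "gen free_word \<Rightarrow>\<^sub>0 laurent" where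
  "XX_inv \<equiv> letter gen_X_inv"

definition Y_gens :: "nat \<Rightarrow> gen set" where
  "Y_gens n = gen_t ` {1..n} \<union> gen_g ` {1..<n} \<union> {gen_X, gen_X_inv}"

text \<open>
  In \<open>e\<^sub>i\<close>, the inverse power of \<open>t\<^sub>i\<^sub>+\<^sub>1\<close> with exponent \<open>s\<close> is written as the power with exponent
  \<open>d - s\<close>; the two agree modulo the relation that the \<open>d\<close>-th power of \<open>t\<^sub>i\<^sub>+\<^sub>1\<close> is 1.
\<close>

definition e_elem :: "nat \<Rightarrow> nat \<Rightarrow> gen free_word \<Rightarrow>\<^sub>0 laurent" where
  "e_elem d i = scalar (laurent_const (1 / of_nat d)) * (\<Sum>s<d. tt i ^ s * tt (i + 1) ^ (d - s))"

inductive Y_rel ::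
    "nat \<Rightarrow> nat \<Rightarrow> nat \<Rightarrow> (gen free_word \<Rightarrow>\<^sub>0 laurent) \<Rightarrow> (gen free_word \<Rightarrow>\<^sub>0 laurent) \<Rightarrow> bool"
  for d m n where
  g_comm: "\<lbrakk>i \<in> {1..<n}; j \<in> {1..<n}; \<bar>int i - int j\<bar> > 1\<rbrakk> \<Longrightarrow>
    Y_rel d m n (gg i * gg j) (gg j * gg i)"
| g_braid: "\<lbrakk>i \<in> {1..<n}; i + 1 \<in> {1..<n}\<rbrakk> \<Longrightarrow>
    Y_rel d m n (gg i * gg (i + 1) * gg i) (gg (i + 1) * gg i * gg (i + 1))"
| t_comm: "\<lbrakk>i \<in> {1..n}; j \<in> {1..n}\<rbrakk> \<Longrightarrow>
    Y_rel d m n (tt i * tt j) (tt j * tt i)"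
| t_g: "\<lbrakk>j \<in> {1..n}; i \<in> {1..<n}\<rbrakk> \<Longrightarrow>
    Y_rel d m n (tt j * gg i) (gg i * tt (Transposition.transpose i (i + 1) j))"
| t_power: "j \<in> {1..n} \<Longrightarrow>
    Y_rel d m n (tt j ^ d) 1"
| g_square: "i \<in> {1..<n} \<Longrightarrow>
    Y_rel d m n (gg i ^ 2) (1 + scalar (indet_powi 0 1 - indet_powi 0 (- 1)) * e_elem d i * gg i)"
| X_g_braid: "1 \<in> {1..<n} \<Longrightarrow>
    Y_rel d m n (XX * gg 1 * XX * gg 1) (gg 1 * XX * gg 1 * XX)"
| X_g_comm: "i \<in> {2..<n} \<Longrightarrow>
    Y_rel d m n (XX * gg i) (gg i * XX)"
| X_t_comm: "j \<in> {1..n} \<Longrightarrow>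
    Y_rel d m n (XX * tt j) (tt j * XX)"
| X_cyclotomic:
    "Y_rel d m n (prod_list (map (\<lambda>l. XX - scalar (indet_powi l 1)) [1..<Suc m])) 0"
| X_inv_right: "Y_rel d m n (XX * XX_inv) 1"
| X_inv_left: "Y_rel d m n (XX_inv * XX) 1"

definition Y_free :: "nat \<Rightarrow> nat \<Rightarrow> (laurent, gen free_word \<Rightarrow>\<^sub>0 laurent) module" where
  "Y_free m n = free_algebra (carrier (R_ring m)) (Y_gens n)"

definition Y_ideal :: "nat \<Rightarrow> nat \<Rightarrow> nat \<Rightarrow> (gen free_word \<Rightarrow>\<^sub>0 laurent) set" where
  "Y_ideal d m n = genideal (Y_free m n) {a - b | a b. Y_rel d m n a b}"

definition Y_algebra :: "nat \<Rightarrow> nat \<Rightarrow> nat \<Rightarrow> (laurent, (gen free_word \<Rightarrow>\<^sub>0 laurent) set) module" where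
  "Y_algebra d m n = quotient_algebra (Y_free m n) (Y_ideal d m n)"

type_synonym FY = "(laurent fract \<times> (gen free_word \<Rightarrow>\<^sub>0 laurent) set \<Rightarrow>\<^sub>0 int) set"

definition FY_algebra :: "nat \<Rightarrow> nat \<Rightarrow> nat \<Rightarrow> (laurent fract, FY) module" where
  "FY_algebra d m n = base_change (R_ring m) fract_of (F_ring m) (Y_algebra d m n)"

definition FY_gen :: "nat \<Rightarrow> nat \<Rightarrow> nat \<Rightarrow> gen \<Rightarrow> FY" where
  "FY_gen d m n g =
     pure_tensor (R_ring m) fract_of (F_ring m) (Y_algebra d m n)
       1 (Y_ideal d m n +>\<^bsub>Y_free m n\<^esub> letter g)"

section \<open>Multipartitions and tableaux\<close>

definition is_partition :: "nat list \<Rightarrow> bool" where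
  "is_partition p \<longleftrightarrow> sorted_wrt (\<ge>) p \<and> 0 \<notin> set p"

text \<open>The node in row \<open>x\<close> and column \<open>y\<close> at position \<open>(k, l)\<close> is \<open>((x, y), k, l)\<close>.\<close>

type_synonym dm_node = "(nat \<times> nat) \<times> nat \<times> nat"

definition dm_nodes :: "nat list list list \<Rightarrow> dm_node set" where
  "dm_nodes \<Lambda> = {((x, y), k, l) | x y k l.
     k \<in> {1..length \<Lambda>} \<and> l \<in> {1..length (\<Lambda> ! (k - 1))} \<and>
     x \<in> {1..length (\<Lambda> ! (k - 1) ! (l - 1))} \<and>
     y \<in> {1..\<Lambda> ! (k - 1) ! (l - 1) ! (x - 1)}}"

definition dm_partitions :: "nat \<Rightarrow> nat \<Rightarrow> nat \<Rightarrow> nat list list list set" where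
  "dm_partitions d m n = {\<Lambda>. length \<Lambda> = d \<and>
     (\<forall>\<mu> \<in> set \<Lambda>. length \<mu> = m \<and> (\<forall>p \<in> set \<mu>. is_partition p)) \<and>
     card (dm_nodes \<Lambda>) = n}"

fun node_pos :: "dm_node \<Rightarrow> nat" where
  "node_pos ((x, y), k, l) = k"

fun qcontent :: "dm_node \<Rightarrow> laurent fract" where
  "qcontent ((x, y), k, l) = vF l * qF powi (2 * (int y - int x))"

text \<open>
  A tableau maps each entry to the node containing it; extensionality makes it unique as a
  function on the natural numbers.
\<close>

type_synonym dm_tableau = "nat \<Rightarrow> dm_node"

definition tableaux :: "nat \<Rightarrow> nat list list list \<Rightarrow> dm_tableau set" where
  "tableaux n \<Lambda> = {T \<in> extensional {1..n}. bij_betw T {1..n} (dm_nodes \<Lambda>)}"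

definition is_standard :: "nat \<Rightarrow> dm_tableau \<Rightarrow> bool" where
  "is_standard n T \<longleftrightarrow> (\<forall>i \<in> {1..n}. \<forall>j \<in> {1..n}. \<forall>x y x' y' k l.
     T i = ((x, y), k, l) \<longrightarrow> T j = ((x', y'), k, l) \<longrightarrow>
     (x = x' \<and> y < y') \<or> (y = y' \<and> x < x') \<longrightarrow> i < j)"

definition standard_tableaux :: "nat \<Rightarrow> nat list list list \<Rightarrow> dm_tableau set" where
  "standard_tableaux n \<Lambda> = {T \<in> tableaux n \<Lambda>. is_standard n T}"

text \<open>Applying \<open>\<sigma>\<close> to the entries: the node that contained \<open>i\<close> contains \<open>\<sigma> i\<close> afterwards.\<close>

definition apply_entries :: "(nat \<Rightarrow> nat) \<Rightarrow> dm_tableau \<Rightarrow> dm_tableau" where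
  "apply_entries \<sigma> T = T \<circ> inv_into UNIV \<sigma>"

section \<open>The representation space\<close>

definition V_module :: "nat \<Rightarrow> nat \<Rightarrow> nat list list list
    \<Rightarrow> (laurent fract, dm_tableau \<Rightarrow>\<^sub>0 laurent fract) module" where
  "V_module m n \<Lambda> = free_module (carrier (F_ring m)) (standard_tableaux n \<Lambda>)"

definition basis_vec :: "nat \<Rightarrow> nat list list list \<Rightarrow> dm_tableau \<Rightarrow> (dm_tableau \<Rightarrow>\<^sub>0 laurent fract)" where
  "basis_vec n \<Lambda> T = (if T \<in> standard_tableaux n \<Lambda> then Poly_Mapping.single T 1 else 0)"

end

theory Submission
  imports Defs "HOL-Combinatorics.Permutations"
begin

text \<open>
  By the universal properties of presented algebras, of extension of scalars and of free modules, it
  suffices to let the generators act by linear operators and to check the defining relations on basis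
  vectors. On a tableau \<open>T\<close>, the operator of \<open>g\<^sub>i\<close> has coefficients depending only on the nodes
  \<open>T i\<close> and \<open>T (i + 1)\<close>, so each relation becomes an identity between rational functions in the
  contents. The denominators do not vanish because, in a standard tableau, two entries on the same
  diagonal of the same diagram differ by at least 3; this covers the three consecutive entries that
  occur in the braid relation.
\<close>

section \<open>Homomorphisms out of quotients and base changes\<close>

text \<open>The obstacle is that the swap of a standard tableau need not be standard. In each
  defining relation, swap coefficients occur as a common factor of both sides or in the product over
  both orders of two nodes, and for neighbouring nodes this product vanishes already in the given
  formula. Hence the operators can be defined on all tableaux, and expanding a relation never asks
  whether a swapped tableau is standard. What remains has few sources: on the plane spanned by a
  tableau and its swap, \<open>g\<^sub>i\<close> has trace \<open>q - 1/q\<close> and determinant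
  -1, and the braid relation comes down to one quadratic identity between three diagonal
  coefficients. The other difficulty is formal. Both coefficient rings are subsets of types with
  infinitely many indeterminates, so linear maps are built and compared on the ambient types and
  only then restricted to carriers.\<close>

definition induced_hom :: "('a \<Rightarrow> 'b) \<Rightarrow> 'a set \<Rightarrow> 'b" where
  "induced_hom h X = h (SOME x. x \<in> X)"

context ring_hom_ring
begin

text \<open>\<open>induced_hom\<close> evaluates at a representative picked by choice, so its value
  is meaningful only on cosets of an ideal inside the kernel: the picked element then differs from
  \<open>x\<close> by something that \<open>h\<close> kills.\<close>

lemma induced_hom_coset:
  assumes "ideal I R" "I \<subseteq> a_kernel R S h" "x \<in> carrier R"
  shows "induced_hom h (I +>\<^bsub>R\<^esub> x) = h x"
proof -
  interpret I: ideal I R by fact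
  have "x \<in> I +>\<^bsub>R\<^esub> x"
    using assms(3) by (rule I.a_rcos_self)
  then have "(SOME y. y \<in> I +>\<^bsub>R\<^esub> x) \<in> I +>\<^bsub>R\<^esub> x"
    by (rule someI)
  then obtain i where i: "i \<in> I" "(SOME y. y \<in> I +>\<^bsub>R\<^esub> x) = i \<oplus>\<^bsub>R\<^esub> x"
    by (auto simp: a_r_coset_def')
  have "i \<in> carrier R" "h i = \<zero>\<^bsub>S\<^esub>"
    using subsetD[OF assms(2) i(1)] unfolding a_kernel_def' by simp_all
  then show ?thesis
    using assms(3) i(2) by (simp add: induced_hom_def)
qed

lemma induced_hom_ring_hom:
  assumes "ideal I R" "I \<subseteq> a_kernel R S h"
  shows "induced_hom h \<in> ring_hom (R Quot I) S"
proof -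
  interpret I: ideal I R by fact
  note coset = induced_hom_coset[OF assms]
  have rep: "\<exists>x \<in> carrier R. X = I +>\<^bsub>R\<^esub> x" if "X \<in> carrier (R Quot I)" for X
    using that by (auto simp: FactRing_simps)
  show ?thesis
  proof (rule ring_hom_memI)
    fix X assume "X \<in> carrier (R Quot I)"
    then obtain x where x: "x \<in> carrier R" "X = I +>\<^bsub>R\<^esub> x"
      using rep by blast
    then show "induced_hom h X \<in> carrier S"
      by (simp add: coset)
    fix Y assume "Y \<in> carrier (R Quot I)"
    then obtain y where y: "y \<in> carrier R" "Y = I +>\<^bsub>R\<^esub> y"
      using rep by blast
    show "induced_hom h (X \<otimes>\<^bsub>R Quot I\<^esub> Y) = induced_hom h X \<otimes>\<^bsub>S\<^esub> induced_hom h Y"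
      using x y by (simp add: FactRing_def I.rcoset_mult_add coset)
    show "induced_hom h (X \<oplus>\<^bsub>R Quot I\<^esub> Y) = induced_hom h X \<oplus>\<^bsub>S\<^esub> induced_hom h Y"
      using x y by (simp add: FactRing_def I.a_rcos_sum coset)
  next
    show "induced_hom h \<one>\<^bsub>R Quot I\<^esub> = \<one>\<^bsub>S\<^esub>"
      by (simp add: FactRing_def coset)
  qed
qed

lemma genideal_subset_a_kernel:
  assumes "U \<subseteq> carrier R" "\<And>u. u \<in> U \<Longrightarrow> h u = \<zero>\<^bsub>S\<^esub>"
  shows "genideal R U \<subseteq> a_kernel R S h"
proof (rule R.genideal_minimal[OF kernel_is_ideal])
  show "U \<subseteq> a_kernel R S h"
    unfolding a_kernel_def' using assms by blast
qed

end

subsection \<open>Extension of scalars\<close>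

lemma pretensor_simps:
  "x \<in> carrier (pretensor S A) \<longleftrightarrow> Poly_Mapping.keys x \<subseteq> carrier S \<times> carrier A"
  "x \<oplus>\<^bsub>pretensor S A\<^esub> y = x + y"
  "\<zero>\<^bsub>pretensor S A\<^esub> = 0"
  "\<one>\<^bsub>pretensor S A\<^esub> = frag_of (\<one>\<^bsub>S\<^esub>, \<one>\<^bsub>A\<^esub>)"
  by (auto simp: pretensor_def)

lemma pretensor_mult_frag_of:
  "frag_of (s, a) \<otimes>\<^bsub>pretensor S A\<^esub> frag_of (s', a') = frag_of (s \<otimes>\<^bsub>S\<^esub> s', a \<otimes>\<^bsub>A\<^esub> a')"
  by (simp add: pretensor_def)

text \<open>Biadditivity holds on the whole type because the product is an additive extension in
  each argument. Differences precede sums since the induction principle for free abelian groups is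
  phrased with differences.\<close>

lemma pretensor_mult_diff_left:
  "(x - y) \<otimes>\<^bsub>pretensor S A\<^esub> z = x \<otimes>\<^bsub>pretensor S A\<^esub> z - y \<otimes>\<^bsub>pretensor S A\<^esub> z"
  by (simp add: pretensor_def frag_extend_diff)

lemma pretensor_mult_diff_right:
  "z \<otimes>\<^bsub>pretensor S A\<^esub> (x - y) = z \<otimes>\<^bsub>pretensor S A\<^esub> x - z \<otimes>\<^bsub>pretensor S A\<^esub> y"
proof -
  \<comment> \<open>The right argument sits inside the function that the outer
    \<open>frag_extend\<close> extends, so additivity in that function is needed as well.\<close>
  have "frag_extend (\<lambda>p. f p - g p) z = frag_extend f z - frag_extend g z"
    for f g :: "'a \<times> 'b \<Rightarrow> 'a \<times> 'b \<Rightarrow>\<^sub>0 int"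
    by (rule poly_mapping_eqI)
      (simp add: frag_extend_def lookup_sum lookup_minus right_diff_distrib sum_subtractf)
  then show ?thesis
    by (simp only: pretensor_def monoid.simps frag_extend_diff split_def)
qed

lemma pretensor_mult_zero:
  "0 \<otimes>\<^bsub>pretensor S A\<^esub> z = 0" "z \<otimes>\<^bsub>pretensor S A\<^esub> 0 = 0"
  by (simp_all add: pretensor_def) (simp add: frag_extend_def split_def)

lemma pretensor_mult_uminus:
  "(- x) \<otimes>\<^bsub>pretensor S A\<^esub> z = - (x \<otimes>\<^bsub>pretensor S A\<^esub> z)"
  "z \<otimes>\<^bsub>pretensor S A\<^esub> (- x) = - (z \<otimes>\<^bsub>pretensor S A\<^esub> x)"
  using pretensor_mult_diff_left[of S A 0 x z] pretensor_mult_diff_right[of S A z 0 x]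
  by (simp_all add: pretensor_mult_zero)

lemma pretensor_mult_add:
  "(x + y) \<otimes>\<^bsub>pretensor S A\<^esub> z = x \<otimes>\<^bsub>pretensor S A\<^esub> z + y \<otimes>\<^bsub>pretensor S A\<^esub> z"
  "z \<otimes>\<^bsub>pretensor S A\<^esub> (x + y) = z \<otimes>\<^bsub>pretensor S A\<^esub> x + z \<otimes>\<^bsub>pretensor S A\<^esub> y"
  using pretensor_mult_diff_left[of S A x "- y" z] pretensor_mult_diff_right[of S A z x "- y"]
  by (simp_all add: pretensor_mult_uminus)

locale ring_extension = S: ring S + A: ring A
  for S :: "('s, 'x) ring_scheme" (structure) and A :: "('r, 'a, 'y) module_scheme" (structure)
begin

abbreviation "P \<equiv> pretensor S A"

lemma pretensor_induct [consumes 1, case_names zero frag_of diff]: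
  assumes "x \<in> carrier P" "Q 0"
    "\<And>s a. s \<in> carrier S \<Longrightarrow> a \<in> carrier A \<Longrightarrow> Q (frag_of (s, a))"
    "\<And>x y. x \<in> carrier P \<Longrightarrow> y \<in> carrier P \<Longrightarrow> Q x \<Longrightarrow> Q y \<Longrightarrow> Q (x - y)"
  shows "Q x"
proof (rule free_Abelian_group_induct[of x "carrier S \<times> carrier A" Q])
  show "Q (y - z)" if "Poly_Mapping.keys y \<subseteq> carrier S \<times> carrier A"
    "Poly_Mapping.keys z \<subseteq> carrier S \<times> carrier A" "Q y" "Q z" for y z
    using that by (intro assms(4)) (simp_all add: pretensor_simps)
qed (use assms(1-3) in \<open>auto simp: pretensor_simps\<close>)

lemma pretensor_frag_of_closed [simp]:
  "frag_of (s, a) \<in> carrier P \<longleftrightarrow> s \<in> carrier S \<and> a \<in> carrier A"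
  by (simp add: pretensor_simps)

lemma pretensor_diff_closed:
  "x \<in> carrier P \<Longrightarrow> y \<in> carrier P \<Longrightarrow> x - y \<in> carrier P"
  unfolding pretensor_simps using keys_diff by fastforce

lemma pretensor_mult_closed:
  assumes "x \<in> carrier P" "y \<in> carrier P"
  shows "x \<otimes>\<^bsub>P\<^esub> y \<in> carrier P"
  using assms(1)
proof (induction rule: pretensor_induct)
  case (frag_of s a)
  show ?case
    using assms(2)
  proof (induction rule: pretensor_induct)
    case (frag_of s' a')
    then show ?case
      using \<open>s \<in> carrier S\<close> \<open>a \<in> carrier A\<close> by (simp add: pretensor_mult_frag_of)
  qed (simp_all add: pretensor_mult_zero pretensor_mult_diff_right pretensor_simps(1)[of 0]
      pretensor_diff_closed)
qed (simp_all add: pretensor_mult_zero pretensor_mult_diff_left pretensor_simps(1)[of 0]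
      pretensor_diff_closed)

lemma pretensor_assoc:
  assumes "x \<in> carrier P" "y \<in> carrier P" "z \<in> carrier P"
  shows "(x \<otimes>\<^bsub>P\<^esub> y) \<otimes>\<^bsub>P\<^esub> z = x \<otimes>\<^bsub>P\<^esub> (y \<otimes>\<^bsub>P\<^esub> z)"
  using assms(1)
proof (induction rule: pretensor_induct)
  case x: (frag_of s a)
  show ?case
    using assms(2)
  proof (induction rule: pretensor_induct)
    case y: (frag_of s' a')
    show ?case
      using assms(3)
    proof (induction rule: pretensor_induct)
      case (frag_of s'' a'')
      then show ?case
        using x y by (simp add: pretensor_mult_frag_of S.m_assoc A.m_assoc)
    qed (simp_all add: pretensor_mult_zero pretensor_mult_diff_right)
  qed (simp_all add: pretensor_mult_zero pretensor_mult_diff_left pretensor_mult_diff_right)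
qed (simp_all add: pretensor_mult_zero pretensor_mult_diff_left)

lemma pretensor_one:
  assumes "x \<in> carrier P"
  shows "\<one>\<^bsub>P\<^esub> \<otimes>\<^bsub>P\<^esub> x = x" "x \<otimes>\<^bsub>P\<^esub> \<one>\<^bsub>P\<^esub> = x"
  using assms
  by (induction rule: pretensor_induct)
    (simp_all add: pretensor_simps(4) pretensor_mult_frag_of pretensor_mult_zero
      pretensor_mult_diff_left pretensor_mult_diff_right)

text \<open>\<open>P\<close> is the integral monoid ring of the product of the multiplicative
  monoids of \<open>S\<close> and \<open>A\<close>. Associativity and unit laws therefore reduce to
  generators; the additions of \<open>S\<close> and \<open>A\<close> enter only later, through the
  relators.\<close>

lemma ring_pretensor: "ring P"
proof (rule ringI)
  show "abelian_group P"
  proof (rule abelian_groupI)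
    fix x assume "x \<in> carrier P"
    then show "\<exists>y \<in> carrier P. y \<oplus>\<^bsub>P\<^esub> x = \<zero>\<^bsub>P\<^esub>"
      by (intro bexI[of _ "- x"]) (simp_all add: pretensor_simps)
  next
    show "x \<oplus>\<^bsub>P\<^esub> y \<in> carrier P" if "x \<in> carrier P" "y \<in> carrier P" for x y
      using that keys_add[of x y] by (auto simp: pretensor_simps)
  qed (simp_all add: pretensor_simps ac_simps)
  show "Group.monoid P"
  proof (rule monoidI)
    show "\<one>\<^bsub>P\<^esub> \<in> carrier P"
      by (simp add: pretensor_simps(4))
  qed (simp_all add: pretensor_mult_closed pretensor_assoc pretensor_one)
qed (simp_all only: pretensor_simps(2) pretensor_mult_add)

end

lemma base_change_simps:
  "carrier (base_change R \<iota> S A) = carrier (pretensor S A Quot tensor_ideal R \<iota> S A)"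
  "x \<otimes>\<^bsub>base_change R \<iota> S A\<^esub> y = x \<otimes>\<^bsub>pretensor S A Quot tensor_ideal R \<iota> S A\<^esub> y"
  "x \<oplus>\<^bsub>base_change R \<iota> S A\<^esub> y = x \<oplus>\<^bsub>pretensor S A Quot tensor_ideal R \<iota> S A\<^esub> y"
  "\<one>\<^bsub>base_change R \<iota> S A\<^esub> = \<one>\<^bsub>pretensor S A Quot tensor_ideal R \<iota> S A\<^esub>"
  "s \<odot>\<^bsub>base_change R \<iota> S A\<^esub> x = pure_tensor R \<iota> S A s \<one>\<^bsub>A\<^esub> \<otimes>\<^bsub>base_change R \<iota> S A\<^esub> x"
  by (simp_all add: base_change_def Let_def ring.defs module.defs)

context ring_extension
begin

lemma tensor_relators_subset:
  assumes "\<And>r a. r \<in> carrier R \<Longrightarrow> a \<in> carrier A \<Longrightarrow> r \<odot>\<^bsub>A\<^esub> a \<in> carrier A"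
    and "\<And>r. r \<in> carrier R \<Longrightarrow> \<iota> r \<in> carrier S"
  shows "tensor_relators R \<iota> S A \<subseteq> carrier P"
  unfolding tensor_relators_def
  by (auto intro!: pretensor_diff_closed assms)

text \<open>This is the universal property of a tensor product of algebras with noncommutative
  target: the tensor of \<open>s\<close> and \<open>a\<close> goes to the product of \<sigma> s and
  \<phi> a, and \<open>comm\<close> is what makes this multiplicative. The last clause holds because
  \<open>s\<close> acts on the base change as multiplication by the tensor of \<open>s\<close> and
  1.\<close>

lemma base_change_hom:
  fixes R :: "('r, 'w) ring_scheme" and E :: "('e, 'z) ring_scheme"
  assumes "ring E" and \<sigma>: "\<sigma> \<in> ring_hom S E" and \<phi>: "\<phi> \<in> ring_hom A E"
    and comm: "\<And>s a. s \<in> carrier S \<Longrightarrow> a \<in> carrier A \<Longrightarrow> \<sigma> s \<otimes>\<^bsub>E\<^esub> \<phi> a = \<phi> a \<otimes>\<^bsub>E\<^esub> \<sigma> s"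
    and smult_closed: "\<And>r a. r \<in> carrier R \<Longrightarrow> a \<in> carrier A \<Longrightarrow> r \<odot>\<^bsub>A\<^esub> a \<in> carrier A"
    and \<iota>_closed: "\<And>r. r \<in> carrier R \<Longrightarrow> \<iota> r \<in> carrier S"
    and smult: "\<And>r a. r \<in> carrier R \<Longrightarrow> a \<in> carrier A \<Longrightarrow> \<phi> (r \<odot>\<^bsub>A\<^esub> a) = \<sigma> (\<iota> r) \<otimes>\<^bsub>E\<^esub> \<phi> a"
  shows "\<exists>\<rho> \<in> ring_hom (base_change R \<iota> S A) E.
    (\<forall>s \<in> carrier S. \<forall>a \<in> carrier A. \<rho> (pure_tensor R \<iota> S A s a) = \<sigma> s \<otimes>\<^bsub>E\<^esub> \<phi> a) \<and>
    (\<forall>s \<in> carrier S. \<forall>x \<in> carrier (base_change R \<iota> S A).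
      \<rho> (s \<odot>\<^bsub>base_change R \<iota> S A\<^esub> x) = \<sigma> s \<otimes>\<^bsub>E\<^esub> \<rho> x)"
proof -
  interpret E: ring E by fact
  interpret P: ring P by (rule ring_pretensor)
  interpret \<sigma>: ring_hom_ring S E \<sigma>
    by (intro ring_hom_ringI2 \<sigma> S.ring_axioms E.ring_axioms)
  interpret \<phi>: ring_hom_ring A E \<phi>
    by (intro ring_hom_ringI2 \<phi> A.ring_axioms E.ring_axioms)
  obtain h where h: "h \<in> hom (free_Abelian_group (carrier S \<times> carrier A)) (add_monoid E)"
    and h_frag: "\<And>p. p \<in> carrier S \<times> carrier A \<Longrightarrow> h (frag_of p) = \<sigma> (fst p) \<otimes>\<^bsub>E\<^esub> \<phi> (snd p)"
    by (rule comm_group.free_Abelian_group_universal[OF E.a_comm_group,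
          of "\<lambda>p. \<sigma> (fst p) \<otimes>\<^bsub>E\<^esub> \<phi> (snd p)" "carrier S \<times> carrier A"]) auto
  have h_frag_of: "h (frag_of (s, a)) = \<sigma> s \<otimes>\<^bsub>E\<^esub> \<phi> a" if "s \<in> carrier S" "a \<in> carrier A" for s a
    using h_frag[of "(s, a)"] that by simp
  have h_closed: "h x \<in> carrier E" if "x \<in> carrier P" for x
    using hom_in_carrier[OF h, of x] that by (simp add: pretensor_simps)
  have h_add: "h (x + y) = h x \<oplus>\<^bsub>E\<^esub> h y" if "x \<in> carrier P" "y \<in> carrier P" for x y
    using hom_mult[OF h, of x y] that by (simp add: pretensor_simps)
  have zero_closed: "0 \<in> carrier P"
    by (simp add: pretensor_simps)
  have h_zero: "h 0 = \<zero>\<^bsub>E\<^esub>"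
    using h_add[OF zero_closed zero_closed] h_closed[OF zero_closed]
    by (metis E.add.r_cancel_one' add.right_neutral)
  have h_diff: "h (x - y) = h x \<ominus>\<^bsub>E\<^esub> h y" if "x \<in> carrier P" "y \<in> carrier P" for x y
  proof -
    have "h x = h (x - y) \<oplus>\<^bsub>E\<^esub> h y"
      using h_add[of "x - y" y] that by (simp add: pretensor_diff_closed)
    then show ?thesis
      using h_closed[of "x - y"] h_closed[of y] that
      by (simp add: pretensor_diff_closed E.minus_eq E.a_assoc E.r_neg)
  qed
  \<comment> \<open>\<open>tensor_ideal\<close> is generated as a two-sided ideal, so killing the
    relators suffices only for a ring homomorphism; multiplicativity has to come before the passage
    to the quotient.\<close>
  have h_mult: "h (x \<otimes>\<^bsub>P\<^esub> y) = h x \<otimes>\<^bsub>E\<^esub> h y" if "x \<in> carrier P" "y \<in> carrier P" for x y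
    using that(1)
  proof (induction rule: pretensor_induct)
    case x: (frag_of s a)
    show ?case
      using that(2)
    proof (induction rule: pretensor_induct)
      case y: (frag_of s' a')
      have "\<sigma> (s \<otimes> s') \<otimes>\<^bsub>E\<^esub> \<phi> (a \<otimes>\<^bsub>A\<^esub> a') = \<sigma> s \<otimes>\<^bsub>E\<^esub> (\<sigma> s' \<otimes>\<^bsub>E\<^esub> \<phi> a) \<otimes>\<^bsub>E\<^esub> \<phi> a'"
        using x y by (simp add: E.m_assoc)
      also have "\<dots> = \<sigma> s \<otimes>\<^bsub>E\<^esub> \<phi> a \<otimes>\<^bsub>E\<^esub> (\<sigma> s' \<otimes>\<^bsub>E\<^esub> \<phi> a')"
        using x y by (simp add: comm[of s' a] E.m_assoc)
      finally show ?case
        using x y by (simp add: pretensor_mult_frag_of h_frag_of)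
    next
      case (diff y z)
      then show ?case
        using x by (simp add: pretensor_mult_diff_right h_diff pretensor_mult_closed h_closed
            E.minus_eq E.r_distr E.r_minus)
    qed (simp add: pretensor_mult_zero h_zero h_closed x)
  next
    case (diff x z)
    then show ?case
      using that(2) by (simp add: pretensor_mult_diff_left h_diff pretensor_mult_closed h_closed
          E.minus_eq E.l_distr E.l_minus)
  qed (simp add: pretensor_mult_zero h_zero h_closed that)
  interpret h: ring_hom_ring P E h
  proof (intro ring_hom_ringI2 ring_hom_memI P.ring_axioms E.ring_axioms)
    show "h \<one>\<^bsub>P\<^esub> = \<one>\<^bsub>E\<^esub>"
      by (simp add: pretensor_simps(4) h_frag_of)
  qed (simp_all add: h_closed h_mult h_add pretensor_simps(2))
  let ?I = "tensor_ideal R \<iota> S A" and ?B = "base_change R \<iota> S A"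
  have relators: "tensor_relators R \<iota> S A \<subseteq> carrier P"
    using smult_closed \<iota>_closed by (rule tensor_relators_subset)
  have ideal: "ideal ?I P"
    unfolding tensor_ideal_def by (rule P.genideal_ideal[OF relators])
  have "h u = \<zero>\<^bsub>E\<^esub>" if "u \<in> tensor_relators R \<iota> S A" for u
    using that unfolding tensor_relators_def
  proof (elim UnE CollectE exE conjE, goal_cases)
    case (1 s s' a)
    then have "h u = \<sigma> s \<otimes>\<^bsub>E\<^esub> \<phi> a \<oplus>\<^bsub>E\<^esub> \<sigma> s' \<otimes>\<^bsub>E\<^esub> \<phi> a \<ominus>\<^bsub>E\<^esub> \<sigma> s \<otimes>\<^bsub>E\<^esub> \<phi> a \<ominus>\<^bsub>E\<^esub> \<sigma> s' \<otimes>\<^bsub>E\<^esub> \<phi> a"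
      by (simp add: h_diff h_frag_of pretensor_diff_closed E.l_distr)
    then show ?case
      using 1 by (simp add: E.minus_eq E.a_ac E.r_neg E.r_neg1 E.r_neg2)
  next
    case (2 s a a')
    then have "h u = \<sigma> s \<otimes>\<^bsub>E\<^esub> \<phi> a \<oplus>\<^bsub>E\<^esub> \<sigma> s \<otimes>\<^bsub>E\<^esub> \<phi> a' \<ominus>\<^bsub>E\<^esub> \<sigma> s \<otimes>\<^bsub>E\<^esub> \<phi> a \<ominus>\<^bsub>E\<^esub> \<sigma> s \<otimes>\<^bsub>E\<^esub> \<phi> a'"
      by (simp add: h_diff h_frag_of pretensor_diff_closed E.r_distr)
    then show ?case
      using 2 by (simp add: E.minus_eq E.a_ac E.r_neg E.r_neg1 E.r_neg2)
  next
    case (3 s r a)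
    then show ?case
      by (simp add: h_diff h_frag_of smult_closed \<iota>_closed smult E.m_assoc E.minus_eq E.r_neg)
  qed
  with relators have ker: "?I \<subseteq> a_kernel P E h"
    unfolding tensor_ideal_def by (rule h.genideal_subset_a_kernel)
  interpret \<rho>: ring_hom_ring "P Quot ?I" E "induced_hom h"
    using h.induced_hom_ring_hom[OF ideal ker] ideal.quotient_is_ring[OF ideal] E.ring_axioms
    by (intro ring_hom_ringI2)
  have pure: "induced_hom h (pure_tensor R \<iota> S A s a) = \<sigma> s \<otimes>\<^bsub>E\<^esub> \<phi> a"
    if "s \<in> carrier S" "a \<in> carrier A" for s a
    using that by (simp add: pure_tensor_def h.induced_hom_coset[OF ideal ker] h_frag_of)
  have pure_closed: "pure_tensor R \<iota> S A s a \<in> carrier (P Quot ?I)"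
    if "s \<in> carrier S" "a \<in> carrier A" for s a
    using that ring_hom_closed[OF ideal.rcos_ring_hom[OF ideal]] by (simp add: pure_tensor_def)
  show ?thesis
  proof (intro bexI conjI ballI)
    show "induced_hom h \<in> ring_hom ?B E"
      by (rule ring_hom_memI) (simp_all only: base_change_simps \<rho>.hom_closed \<rho>.hom_mult \<rho>.hom_add \<rho>.hom_one)
    show "induced_hom h (s \<odot>\<^bsub>?B\<^esub> x) = \<sigma> s \<otimes>\<^bsub>E\<^esub> induced_hom h x"
      if "s \<in> carrier S" "x \<in> carrier ?B" for s x
      using that by (simp add: base_change_simps pure pure_closed)
  qed (rule pure)
qed

end

section \<open>Endomorphism algebras\<close>

lemma End_algebra_simps:
  "\<phi> \<otimes>\<^bsub>End_algebra K M\<^esub> \<psi> = compose (carrier M) \<phi> \<psi>"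
  "\<phi> \<oplus>\<^bsub>End_algebra K M\<^esub> \<psi> = (\<lambda>x \<in> carrier M. \<phi> x \<oplus>\<^bsub>M\<^esub> \<psi> x)"
  "\<one>\<^bsub>End_algebra K M\<^esub> = (\<lambda>x \<in> carrier M. x)"
  "\<zero>\<^bsub>End_algebra K M\<^esub> = (\<lambda>x \<in> carrier M. \<zero>\<^bsub>M\<^esub>)"
  "c \<odot>\<^bsub>End_algebra K M\<^esub> \<phi> = (\<lambda>x \<in> carrier M. c \<odot>\<^bsub>M\<^esub> \<phi> x)"
  by (simp_all add: End_algebra_def)

context module
begin

abbreviation "E \<equiv> End_algebra R M"

lemma End_memI:
  assumes "\<And>x. x \<in> carrier M \<Longrightarrow> \<phi> x \<in> carrier M"
    "\<And>x y. x \<in> carrier M \<Longrightarrow> y \<in> carrier M \<Longrightarrow> \<phi> (x \<oplus>\<^bsub>M\<^esub> y) = \<phi> x \<oplus>\<^bsub>M\<^esub> \<phi> y"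
    "\<And>c x. c \<in> carrier R \<Longrightarrow> x \<in> carrier M \<Longrightarrow> \<phi> (c \<odot>\<^bsub>M\<^esub> x) = c \<odot>\<^bsub>M\<^esub> \<phi> x"
  shows "restrict \<phi> (carrier M) \<in> carrier E"
  using assms by (simp add: End_algebra_def)

lemma End_memD:
  assumes "\<phi> \<in> carrier E"
  shows "x \<in> carrier M \<Longrightarrow> \<phi> x \<in> carrier M"
    and "x \<in> carrier M \<Longrightarrow> y \<in> carrier M \<Longrightarrow> \<phi> (x \<oplus>\<^bsub>M\<^esub> y) = \<phi> x \<oplus>\<^bsub>M\<^esub> \<phi> y"
    and "c \<in> carrier R \<Longrightarrow> x \<in> carrier M \<Longrightarrow> \<phi> (c \<odot>\<^bsub>M\<^esub> x) = c \<odot>\<^bsub>M\<^esub> \<phi> x"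
    and "\<phi> \<in> extensional (carrier M)"
  using assms by (auto simp: End_algebra_def PiE_def)

lemma End_eqI:
  assumes "\<phi> \<in> extensional (carrier M)" "\<psi> \<in> extensional (carrier M)"
    and "\<And>x. x \<in> carrier M \<Longrightarrow> \<phi> x = \<psi> x"
  shows "\<phi> = \<psi>"
  using assms by (rule extensionalityI)

lemma ring_End: "ring E"
proof (rule ringI)
  show "abelian_group E"
  proof (rule abelian_groupI)
    fix \<phi> \<psi> assume "\<phi> \<in> carrier E" "\<psi> \<in> carrier E"
    then show "\<phi> \<oplus>\<^bsub>E\<^esub> \<psi> \<in> carrier E"
      unfolding End_algebra_simps
      by (intro End_memI) (simp_all add: End_memD M.a_ac smult_r_distr)
    show "\<phi> \<oplus>\<^bsub>E\<^esub> \<psi> = \<psi> \<oplus>\<^bsub>E\<^esub> \<phi>"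
      using \<open>\<phi> \<in> carrier E\<close> \<open>\<psi> \<in> carrier E\<close>
      by (simp add: End_algebra_simps End_memD M.a_comm cong: restrict_cong)
    fix \<chi> assume "\<chi> \<in> carrier E"
    then show "(\<phi> \<oplus>\<^bsub>E\<^esub> \<psi>) \<oplus>\<^bsub>E\<^esub> \<chi> = \<phi> \<oplus>\<^bsub>E\<^esub> (\<psi> \<oplus>\<^bsub>E\<^esub> \<chi>)"
      using \<open>\<phi> \<in> carrier E\<close> \<open>\<psi> \<in> carrier E\<close>
      by (simp add: End_algebra_simps End_memD M.a_assoc cong: restrict_cong)
  next
    show "\<zero>\<^bsub>E\<^esub> \<in> carrier E"
      unfolding End_algebra_simps by (intro End_memI) simp_all
  next
    fix \<phi> assume \<phi>: "\<phi> \<in> carrier E"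
    then show "\<zero>\<^bsub>E\<^esub> \<oplus>\<^bsub>E\<^esub> \<phi> = \<phi>"
      by (intro End_eqI) (simp_all add: End_algebra_simps End_memD)
    have "(\<lambda>x \<in> carrier M. \<ominus>\<^bsub>M\<^esub> \<phi> x) \<in> carrier E"
      using \<phi> by (intro End_memI) (simp_all add: End_memD M.minus_add smult_r_minus)
    with \<phi> show "\<exists>\<psi> \<in> carrier E. \<psi> \<oplus>\<^bsub>E\<^esub> \<phi> = \<zero>\<^bsub>E\<^esub>"
      by (intro bexI[of _ "\<lambda>x \<in> carrier M. \<ominus>\<^bsub>M\<^esub> \<phi> x"])
        (simp_all add: End_algebra_simps End_memD M.l_neg cong: restrict_cong)
  qed
  show "Group.monoid E"
  proof (rule monoidI)
    fix \<phi> \<psi> assume "\<phi> \<in> carrier E" "\<psi> \<in> carrier E"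
    then show "\<phi> \<otimes>\<^bsub>E\<^esub> \<psi> \<in> carrier E"
      unfolding End_algebra_simps compose_def by (intro End_memI) (simp_all add: End_memD)
    fix \<chi> assume "\<chi> \<in> carrier E"
    then show "(\<phi> \<otimes>\<^bsub>E\<^esub> \<psi>) \<otimes>\<^bsub>E\<^esub> \<chi> = \<phi> \<otimes>\<^bsub>E\<^esub> (\<psi> \<otimes>\<^bsub>E\<^esub> \<chi>)"
      by (simp add: End_algebra_simps compose_def End_memD cong: restrict_cong)
  next
    show "\<one>\<^bsub>E\<^esub> \<in> carrier E"
      unfolding End_algebra_simps by (intro End_memI) simp_all
  next
    fix \<phi> assume \<phi>: "\<phi> \<in> carrier E"
    then show "\<one>\<^bsub>E\<^esub> \<otimes>\<^bsub>E\<^esub> \<phi> = \<phi>" "\<phi> \<otimes>\<^bsub>E\<^esub> \<one>\<^bsub>E\<^esub> = \<phi>"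
      by (auto intro!: End_eqI simp: End_algebra_simps compose_def End_memD)
  qed
next
  fix \<phi> \<psi> \<chi> assume *: "\<phi> \<in> carrier E" "\<psi> \<in> carrier E" "\<chi> \<in> carrier E"
  then show "(\<phi> \<oplus>\<^bsub>E\<^esub> \<psi>) \<otimes>\<^bsub>E\<^esub> \<chi> = \<phi> \<otimes>\<^bsub>E\<^esub> \<chi> \<oplus>\<^bsub>E\<^esub> \<psi> \<otimes>\<^bsub>E\<^esub> \<chi>"
    by (simp add: End_algebra_simps compose_def End_memD cong: restrict_cong)
  show "\<chi> \<otimes>\<^bsub>E\<^esub> (\<phi> \<oplus>\<^bsub>E\<^esub> \<psi>) = \<chi> \<otimes>\<^bsub>E\<^esub> \<phi> \<oplus>\<^bsub>E\<^esub> \<chi> \<otimes>\<^bsub>E\<^esub> \<psi>"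
    using * by (simp add: End_algebra_simps compose_def End_memD cong: restrict_cong)
qed

definition homothety :: "'a \<Rightarrow> 'c \<Rightarrow> 'c" where
  "homothety c = (\<lambda>x \<in> carrier M. c \<odot>\<^bsub>M\<^esub> x)"

lemma homothety_ring_hom: "homothety \<in> ring_hom R E"
proof (rule ring_hom_memI)
  fix c assume c: "c \<in> carrier R"
  then show "homothety c \<in> carrier E"
    unfolding homothety_def
    by (intro End_memI) (simp_all add: smult_r_distr R.m_comm flip: smult_assoc1)
  fix c' assume c': "c' \<in> carrier R"
  show "homothety (c \<otimes> c') = homothety c \<otimes>\<^bsub>E\<^esub> homothety c'"
    using c c' by (simp add: homothety_def End_algebra_simps compose_def smult_assoc1 cong: restrict_cong)
  show "homothety (c \<oplus> c') = homothety c \<oplus>\<^bsub>E\<^esub> homothety c'"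
    using c c' by (simp add: homothety_def End_algebra_simps smult_l_distr cong: restrict_cong)
qed (simp add: homothety_def End_algebra_simps cong: restrict_cong)

text \<open>Linearity means commuting with scalars, so homotheties are central in the endomorphism
  ring. That is the commutation required by \<open>base_change_hom\<close>.\<close>

lemma homothety_mult:
  assumes "c \<in> carrier R" "\<phi> \<in> carrier E"
  shows "homothety c \<otimes>\<^bsub>E\<^esub> \<phi> = c \<odot>\<^bsub>E\<^esub> \<phi>" "\<phi> \<otimes>\<^bsub>E\<^esub> homothety c = c \<odot>\<^bsub>E\<^esub> \<phi>"
  using assms by (simp_all add: homothety_def End_algebra_simps compose_def End_memD cong: restrict_cong)

end

text \<open>The universal property is applied with homotheties as the homomorphism on
  \<open>S\<close>. Multiplication by a homothety is the scalar action on endomorphisms, so the ring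
  homomorphism obtained is automatically one of \<open>S\<close>-algebras.\<close>

lemma (in ring_extension) base_change_representation:
  fixes R :: "('r, 'w) ring_scheme" and M :: "('s, 'm, 'z) module_scheme"
  assumes "module S M" and \<phi>: "\<phi> \<in> ring_hom A (End_algebra S M)"
    and smult_closed: "\<And>r a. r \<in> carrier R \<Longrightarrow> a \<in> carrier A \<Longrightarrow> r \<odot>\<^bsub>A\<^esub> a \<in> carrier A"
    and \<iota>_closed: "\<And>r. r \<in> carrier R \<Longrightarrow> \<iota> r \<in> carrier S"
    and smult: "\<And>r a. r \<in> carrier R \<Longrightarrow> a \<in> carrier A \<Longrightarrow>
      \<phi> (r \<odot>\<^bsub>A\<^esub> a) = \<iota> r \<odot>\<^bsub>End_algebra S M\<^esub> \<phi> a"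
  shows "\<exists>\<rho> \<in> representations S (base_change R \<iota> S A) M.
    \<forall>a \<in> carrier A. \<rho> (pure_tensor R \<iota> S A \<one> a) = \<phi> a"
proof -
  interpret M: module S M by fact
  interpret E: ring M.E by (rule M.ring_End)
  have \<phi>_closed: "\<phi> a \<in> carrier M.E" if "a \<in> carrier A" for a
    using \<phi> that by (rule ring_hom_closed)
  have homothety_\<phi>: "M.homothety s \<otimes>\<^bsub>M.E\<^esub> \<phi> a = s \<odot>\<^bsub>M.E\<^esub> \<phi> a" if "s \<in> carrier S" "a \<in> carrier A" for s a
    using that by (simp add: M.homothety_mult \<phi>_closed)
  have comm: "M.homothety s \<otimes>\<^bsub>M.E\<^esub> \<phi> a = \<phi> a \<otimes>\<^bsub>M.E\<^esub> M.homothety s"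
    if "s \<in> carrier S" "a \<in> carrier A" for s a
    using that by (simp add: M.homothety_mult \<phi>_closed)
  have smult': "\<phi> (r \<odot>\<^bsub>A\<^esub> a) = M.homothety (\<iota> r) \<otimes>\<^bsub>M.E\<^esub> \<phi> a"
    if "r \<in> carrier R" "a \<in> carrier A" for r a
    using that by (simp add: M.homothety_mult \<phi>_closed smult \<iota>_closed)
  have "\<exists>\<rho> \<in> ring_hom (base_change R \<iota> S A) M.E.
    (\<forall>s \<in> carrier S. \<forall>a \<in> carrier A.
      \<rho> (pure_tensor R \<iota> S A s a) = M.homothety s \<otimes>\<^bsub>M.E\<^esub> \<phi> a) \<and>
    (\<forall>s \<in> carrier S. \<forall>x \<in> carrier (base_change R \<iota> S A).
      \<rho> (s \<odot>\<^bsub>base_change R \<iota> S A\<^esub> x) = M.homothety s \<otimes>\<^bsub>M.E\<^esub> \<rho> x)"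
    by (rule base_change_hom[OF M.ring_End M.homothety_ring_hom \<phi>])
      (fact comm smult_closed \<iota>_closed smult')+
  then obtain \<rho> where \<rho>: "\<rho> \<in> ring_hom (base_change R \<iota> S A) M.E"
    "\<And>s a. s \<in> carrier S \<Longrightarrow> a \<in> carrier A \<Longrightarrow>
      \<rho> (pure_tensor R \<iota> S A s a) = M.homothety s \<otimes>\<^bsub>M.E\<^esub> \<phi> a"
    "\<And>s x. s \<in> carrier S \<Longrightarrow> x \<in> carrier (base_change R \<iota> S A) \<Longrightarrow>
      \<rho> (s \<odot>\<^bsub>base_change R \<iota> S A\<^esub> x) = M.homothety s \<otimes>\<^bsub>M.E\<^esub> \<rho> x"
    by blast
  show ?thesis
  proof (intro bexI ballI)
    show "\<rho> \<in> representations S (base_change R \<iota> S A) M"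
      using \<rho>(1,3) by (simp add: representations_def alg_hom_def M.homothety_mult ring_hom_closed)
    show "\<rho> (pure_tensor R \<iota> S A \<one> a) = \<phi> a" if "a \<in> carrier A" for a
      using that ring_hom_one[OF M.homothety_ring_hom] by (simp add: \<rho>(2) \<phi>_closed)
  qed
qed

section \<open>Free modules and representations of free algebras\<close>

text \<open>The scalar action of \<open>free_module\<close>, named so that its laws can be stated on
  the whole type, without carriers.\<close>

definition scale :: "'c::comm_ring_1 \<Rightarrow> ('s \<Rightarrow>\<^sub>0 'c) \<Rightarrow> 's \<Rightarrow>\<^sub>0 'c" where
  "scale c = Poly_Mapping.map ((*) c)"

lemma lookup_scale: "Poly_Mapping.lookup (scale c v) k = c * Poly_Mapping.lookup v k"
  by (simp add: scale_def Poly_Mapping.map.rep_eq when_def)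

lemma scale_add_right: "scale c (u + v) = scale c u + scale c v"
  by (rule poly_mapping_eqI) (simp add: lookup_scale lookup_add distrib_left)

lemma scale_add_left: "scale (c + c') v = scale c v + scale c' v"
  by (rule poly_mapping_eqI) (simp add: lookup_scale lookup_add distrib_right)

lemma scale_scale [simp]: "scale c (scale c' v) = scale (c * c') v"
  by (rule poly_mapping_eqI) (simp add: lookup_scale mult.assoc)

lemma scale_one [simp]: "scale 1 v = v"
  by (rule poly_mapping_eqI) (simp add: lookup_scale)

lemma scale_zero [simp]: "scale 0 v = 0" "scale c 0 = 0"
  by (rule poly_mapping_eqI, simp add: lookup_scale)+

lemma scale_minus_left: "scale (- c) v = - scale c v"
  by (rule poly_mapping_eqI) (simp add: lookup_scale)

lemma scale_sum_right: "scale c (sum f I) = (\<Sum>i\<in>I. scale c (f i))"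
  by (rule poly_mapping_eqI) (simp add: lookup_scale lookup_sum sum_distrib_left)

text \<open>Cancellation can make the key set of \<open>f + g\<close> smaller than the union of the
  two. The parameter \<iota> lets one statement serve both linear extension, where it is the
  identity, and the evaluation of polynomials whose coefficients change ring.\<close>

lemma sum_scale_keys_plus:
  "(\<Sum>k\<in>Poly_Mapping.keys (f + g). scale (\<iota> (Poly_Mapping.lookup (f + g) k)) (b k)) =
   (\<Sum>k\<in>Poly_Mapping.keys f. scale (\<iota> (Poly_Mapping.lookup f k)) (b k)) +
   (\<Sum>k\<in>Poly_Mapping.keys g. scale (\<iota> (Poly_Mapping.lookup g k)) (b k))"
  if "\<iota> 0 = 0" "\<And>x y. \<iota> (x + y) = \<iota> x + \<iota> y"
  by (rule setsum_keys_plus_distrib) (simp_all add: that scale_add_left)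

lemma poly_mapping_single_induct [case_names single sum]:
  fixes f :: "'k \<Rightarrow>\<^sub>0 'v::comm_monoid_add"
  assumes single: "\<And>k v. P (Poly_Mapping.single k v)"
    and sum: "\<And>f g. P f \<Longrightarrow> P g \<Longrightarrow> P (f + g)"
  shows "P f"
proof -
  have "f = (\<Sum>k\<in>Poly_Mapping.keys f. Poly_Mapping.single k (Poly_Mapping.lookup f k))"
    by (rule poly_mapping_eqI) (simp add: lookup_sum lookup_single when_def in_keys_iff)
  \<comment> \<open>The zero function is \<open>single undefined 0\<close>, which settles the empty
    sum.\<close>
  moreover have "P (\<Sum>k\<in>I. Poly_Mapping.single k (Poly_Mapping.lookup f k))" for I
    using single[of undefined 0]
    by (induction I rule: infinite_finite_induct) (simp_all add: single sum)
  ultimately show ?thesis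
    by metis
qed

text \<open>Linearity is over the full coefficient type and on all finitely supported functions;
  preservation of a free module over a subring is kept separate, in
  \<open>lin_ext_closed\<close>.\<close>

definition linear_op :: "(('s \<Rightarrow>\<^sub>0 'c::comm_ring_1) \<Rightarrow> ('t \<Rightarrow>\<^sub>0 'c)) \<Rightarrow> bool" where
  "linear_op f \<longleftrightarrow> (\<forall>u v. f (u + v) = f u + f v) \<and> (\<forall>c v. f (scale c v) = scale c (f v))"

lemma linear_op_add: "linear_op f \<Longrightarrow> f (u + v) = f u + f v"
  and linear_op_scale: "linear_op f \<Longrightarrow> f (scale c v) = scale c (f v)"
  by (simp_all add: linear_op_def)

lemma linear_op_zero: "linear_op f \<Longrightarrow> f 0 = 0"
  using linear_op_scale[of f 0 0] by simp

lemma linear_op_sum: "linear_op f \<Longrightarrow> f (sum g I) = (\<Sum>i\<in>I. f (g i))"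
  by (induction I rule: infinite_finite_induct) (simp_all add: linear_op_zero linear_op_add)

lemma linear_op_id: "linear_op (\<lambda>v. v)"
  by (simp add: linear_op_def)

lemma linear_op_sum_scale: "(\<And>i. i \<in> I \<Longrightarrow> linear_op (f i)) \<Longrightarrow> linear_op (\<lambda>v. \<Sum>i\<in>I. scale (c i) (f i v))"
  by (simp add: linear_op_def scale_add_right sum.distrib scale_sum_right mult.commute)

definition lin_ext :: "('s \<Rightarrow> 't \<Rightarrow>\<^sub>0 'c::comm_ring_1) \<Rightarrow> ('s \<Rightarrow>\<^sub>0 'c) \<Rightarrow> ('t \<Rightarrow>\<^sub>0 'c)" where
  "lin_ext b v = (\<Sum>k\<in>Poly_Mapping.keys v. scale (Poly_Mapping.lookup v k) (b k))"

lemma lin_ext_single [simp]: "lin_ext b (Poly_Mapping.single k 1) = b k"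
  by (simp add: lin_ext_def)

lemma linear_op_lin_ext: "linear_op (lin_ext b)"
proof -
  have "lin_ext b (scale c v) = scale c (lin_ext b v)" for c v
  proof -
    \<comment> \<open>Scaling may remove keys, so the sum is extended by zero terms to all keys of
      \<open>v\<close>.\<close>
    have "lin_ext b (scale c v) =
      (\<Sum>k\<in>Poly_Mapping.keys v. scale (Poly_Mapping.lookup (scale c v) k) (b k))"
      unfolding lin_ext_def
      by (rule sum.mono_neutral_left) (auto simp: in_keys_iff lookup_scale)
    then show ?thesis
      by (simp add: lin_ext_def lookup_scale scale_sum_right)
  qed
  moreover have "lin_ext b (u + v) = lin_ext b u + lin_ext b v" for u v
    unfolding lin_ext_def by (rule sum_scale_keys_plus) simp_all
  ultimately show ?thesis
    by (simp add: linear_op_def)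
qed

lemma lin_ext_expansion: "lin_ext (\<lambda>k. Poly_Mapping.single k 1) v = v"
proof (rule poly_mapping_eqI)
  fix k
  show "Poly_Mapping.lookup (lin_ext (\<lambda>k. Poly_Mapping.single k 1) v) k = Poly_Mapping.lookup v k"
    by (cases "k \<in> Poly_Mapping.keys v")
      (simp_all add: lin_ext_def lookup_sum lookup_scale lookup_single when_def sum.If_cases in_keys_iff
        if_distrib[of "(*) c" for c] cong: if_cong)
qed

lemma linear_op_eqI:
  assumes "linear_op f" "linear_op g" "Poly_Mapping.keys v \<subseteq> S"
    and "\<And>k. k \<in> S \<Longrightarrow> f (Poly_Mapping.single k 1) = g (Poly_Mapping.single k 1)"
  shows "f v = g v"
proof -
  have expand: "h v = (\<Sum>k\<in>Poly_Mapping.keys v. scale (Poly_Mapping.lookup v k) (h (Poly_Mapping.single k 1)))"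
    if "linear_op h" for h :: "('a \<Rightarrow>\<^sub>0 'b) \<Rightarrow> 'c \<Rightarrow>\<^sub>0 'b"
    by (subst (1) lin_ext_expansion [of v, symmetric])
      (simp add: lin_ext_def linear_op_sum[OF that] linear_op_scale[OF that])
  have "f (Poly_Mapping.single k 1) = g (Poly_Mapping.single k 1)" if "k \<in> Poly_Mapping.keys v" for k
    using assms(3,4) that by blast
  then show ?thesis
    unfolding expand[OF assms(1)] expand[OF assms(2)] by (intro sum.cong) simp_all
qed

text \<open>A unital subring given as a subset of a type. The rings of Laurent polynomials and of
  fractions depend on the variable \<open>m\<close>, so they cannot be types themselves.\<close>

locale coefficients =
  fixes C :: "'c::comm_ring_1 set"
  assumes zero_mem: "0 \<in> C" and one_mem: "1 \<in> C"
    and add_mem: "\<And>x y. x \<in> C \<Longrightarrow> y \<in> C \<Longrightarrow> x + y \<in> C"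
    and mult_mem: "\<And>x y. x \<in> C \<Longrightarrow> y \<in> C \<Longrightarrow> x * y \<in> C"
    and uminus_mem: "\<And>x. x \<in> C \<Longrightarrow> - x \<in> C"
begin

lemma cring_ring_on: "cring (ring_on C)"
proof (rule cringI)
  show "abelian_group (ring_on C)"
  proof (rule abelian_groupI)
    fix x assume "x \<in> carrier (ring_on C)"
    then show "\<exists>y \<in> carrier (ring_on C). y \<oplus>\<^bsub>ring_on C\<^esub> x = \<zero>\<^bsub>ring_on C\<^esub>"
      using uminus_mem by (auto simp: ring_on_def intro!: bexI[of _ "- x"])
  qed (use zero_mem add_mem in \<open>simp_all add: ring_on_def ac_simps\<close>)
  show "comm_monoid (ring_on C)"
    by (rule comm_monoidI) (use one_mem mult_mem in \<open>simp_all add: ring_on_def ac_simps\<close>)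
qed (simp add: ring_on_def distrib_right)

lemma sum_mem: "(\<And>i. i \<in> I \<Longrightarrow> f i \<in> C) \<Longrightarrow> sum f I \<in> C"
  by (induction I rule: infinite_finite_induct) (auto intro: zero_mem add_mem)

lemma Sum_any_mem: "(\<And>i. f i \<in> C) \<Longrightarrow> Sum_any f \<in> C"
  by (simp add: Sum_any.expand_set sum_mem)

lemma free_module_simps:
  "v \<in> carrier (free_module C S) \<longleftrightarrow>
     Poly_Mapping.keys v \<subseteq> S \<and> (\<forall>s. Poly_Mapping.lookup v s \<in> C)"
  "u \<oplus>\<^bsub>free_module C S\<^esub> v = u + v"
  "\<zero>\<^bsub>free_module C S\<^esub> = 0"
  "c \<odot>\<^bsub>free_module C S\<^esub> v = scale c v"
  by (simp_all add: free_module_def scale_def)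

lemma free_module_add_closed:
  assumes "u \<in> carrier (free_module C S)" "v \<in> carrier (free_module C S)"
  shows "u + v \<in> carrier (free_module C S)"
  using assms keys_add[of u v] by (auto simp: free_module_simps lookup_add add_mem)

lemma free_module_zero_closed: "0 \<in> carrier (free_module C S)"
  by (simp add: free_module_simps zero_mem)

lemma free_module_sum_closed:
  assumes "\<And>i. i \<in> I \<Longrightarrow> f i \<in> carrier (free_module C S)"
  shows "sum f I \<in> carrier (free_module C S)"
  using assms
  by (induction I rule: infinite_finite_induct)
    (auto intro: free_module_zero_closed free_module_add_closed)

lemma free_module_scale_closed:
  assumes "c \<in> C" "v \<in> carrier (free_module C S)"
  shows "scale c v \<in> carrier (free_module C S)"
  using assms(2) mult_mem[OF assms(1)]
  by (fastforce simp: free_module_simps lookup_scale in_keys_iff)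

lemma free_module_uminus_closed:
  assumes "v \<in> carrier (free_module C S)"
  shows "- v \<in> carrier (free_module C S)"
  using assms by (simp add: free_module_simps uminus_mem)

lemma free_module_single_closed:
  assumes "c \<in> C" "s \<in> S"
  shows "Poly_Mapping.single s c \<in> carrier (free_module C S)"
  using assms by (auto simp: free_module_simps lookup_single when_def zero_mem)

lemma abelian_group_free_module: "abelian_group (free_module C S)"
proof (rule abelian_groupI)
  fix v assume "v \<in> carrier (free_module C S)"
  then show "\<exists>u \<in> carrier (free_module C S). u \<oplus>\<^bsub>free_module C S\<^esub> v = \<zero>\<^bsub>free_module C S\<^esub>"
    by (intro bexI[of _ "- v"]) (simp_all add: free_module_simps(2,3) free_module_uminus_closed)
qed (simp_all add: free_module_simps(2,3) free_module_add_closed free_module_zero_closed ac_simps)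

lemma module_free_module: "module (ring_on C) (free_module C S)"
  by (rule moduleI[OF cring_ring_on abelian_group_free_module])
    (simp_all add: free_module_simps(2-4) free_module_scale_closed ring_on_def
      scale_add_left scale_add_right)

lemma lin_ext_closed:
  assumes "v \<in> carrier (free_module C S)"
    and "\<And>s. s \<in> S \<Longrightarrow> b s \<in> carrier (free_module C S')"
  shows "lin_ext b v \<in> carrier (free_module C S')"
  unfolding lin_ext_def using assms
  by (intro free_module_sum_closed free_module_scale_closed) (auto simp: free_module_simps)

subsection \<open>Free algebras\<close>

lemma free_algebra_simps:
  "carrier (free_algebra C G) = carrier (free_module C {w. set (letters w) \<subseteq> G})"
  "f \<otimes>\<^bsub>free_algebra C G\<^esub> g = f * g"
  "f \<oplus>\<^bsub>free_algebra C G\<^esub> g = f + g"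
  "\<one>\<^bsub>free_algebra C G\<^esub> = 1"
  "\<zero>\<^bsub>free_algebra C G\<^esub> = 0"
  "c \<odot>\<^bsub>free_algebra C G\<^esub> f = scale c f"
  by (simp_all add: free_algebra_def free_module_def scale_def)

lemma scalar_closed: "c \<in> C \<Longrightarrow> scalar c \<in> carrier (free_algebra C G)"
  unfolding free_algebra_simps scalar_def
  by (rule free_module_single_closed) (simp_all add: zero_free_word_def)

lemma letter_closed: "g \<in> G \<Longrightarrow> letter g \<in> carrier (free_algebra C G)"
  unfolding free_algebra_simps letter_def
  by (rule free_module_single_closed) (simp_all add: one_mem)

lemma free_algebra_mult_closed:
  assumes "f \<in> carrier (free_algebra C G)" "g \<in> carrier (free_algebra C G)"
  shows "f * g \<in> carrier (free_algebra C G)"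
proof -
  have "Poly_Mapping.lookup (f * g) w \<in> C" for w
    using assms unfolding lookup_mult
    by (intro Sum_any_mem mult_mem)
      (auto simp: free_algebra_simps free_module_simps when_def zero_mem)
  moreover have "Poly_Mapping.keys (f * g) \<subseteq> {w. set (letters w) \<subseteq> G}"
    using keys_mult[of f g] assms
    by (fastforce simp: free_algebra_simps free_module_simps plus_free_word_def)
  ultimately show ?thesis
    by (simp add: free_algebra_simps free_module_simps)
qed

lemma one_free_algebra_closed: "1 \<in> carrier (free_algebra C G)"
  using scalar_closed[OF one_mem] by (simp add: scalar_def)

lemma free_algebra_add_closed:
  "f \<in> carrier (free_algebra C G) \<Longrightarrow> g \<in> carrier (free_algebra C G) \<Longrightarrow>
     f + g \<in> carrier (free_algebra C G)"
  by (simp add: free_algebra_simps free_module_add_closed)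

lemma free_algebra_diff_closed:
  assumes "f \<in> carrier (free_algebra C G)" "g \<in> carrier (free_algebra C G)"
  shows "f - g \<in> carrier (free_algebra C G)"
  using free_algebra_add_closed[OF assms(1), of "- g"] assms(2)
  by (simp add: free_algebra_simps free_module_uminus_closed)

lemma free_algebra_power_closed:
  "f \<in> carrier (free_algebra C G) \<Longrightarrow> f ^ k \<in> carrier (free_algebra C G)"
  by (induction k) (simp_all add: one_free_algebra_closed free_algebra_mult_closed)

lemma free_algebra_sum_closed:
  "(\<And>i. i \<in> I \<Longrightarrow> f i \<in> carrier (free_algebra C G)) \<Longrightarrow> sum f I \<in> carrier (free_algebra C G)"
  by (simp add: free_algebra_simps free_module_sum_closed)

lemma free_algebra_prod_list_closed:
  "set fs \<subseteq> carrier (free_algebra C G) \<Longrightarrow> prod_list fs \<in> carrier (free_algebra C G)"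
  by (induction fs) (simp_all add: one_free_algebra_closed free_algebra_mult_closed)

lemmas free_algebra_closed_intros =
  letter_closed scalar_closed one_free_algebra_closed free_algebra_add_closed
  free_algebra_diff_closed free_algebra_mult_closed free_algebra_power_closed
  free_algebra_sum_closed free_algebra_prod_list_closed

lemma ring_free_algebra: "ring (free_algebra C G)"
proof (rule ringI)
  show "abelian_group (free_algebra C G)"
  proof (rule abelian_groupI)
    fix f assume "f \<in> carrier (free_algebra C G)"
    then show "\<exists>g \<in> carrier (free_algebra C G). g \<oplus>\<^bsub>free_algebra C G\<^esub> f = \<zero>\<^bsub>free_algebra C G\<^esub>"
      by (intro bexI[of _ "- f"]) (simp_all add: free_algebra_simps free_module_uminus_closed)
  qed (simp_all add: free_algebra_simps free_module_add_closed free_module_zero_closed ac_simps)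
  show "Group.monoid (free_algebra C G)"
    by (rule monoidI)
      (simp_all add: free_algebra_simps(2,4) free_algebra_mult_closed one_free_algebra_closed mult.assoc)
qed (simp_all add: free_algebra_simps(2,3) distrib_left distrib_right)

end

lemma scalar_mult: "scalar c * f = scale c f"
proof (induction f rule: poly_mapping_single_induct)
  case (single k v)
  show ?case
    by (rule poly_mapping_eqI) (simp add: scalar_def mult_single lookup_scale lookup_single when_def)
qed (simp add: distrib_left scale_add_right)

subsection \<open>Evaluation of noncommutative polynomials\<close>

locale coefficient_hom =
  fixes \<iota> :: "'r::comm_ring_1 \<Rightarrow> 'c::comm_ring_1"
  assumes hom_zero: "\<iota> 0 = 0" and hom_one: "\<iota> 1 = 1"
    and hom_add: "\<iota> (x + y) = \<iota> x + \<iota> y" and hom_mult: "\<iota> (x * y) = \<iota> x * \<iota> y"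
begin

text \<open>\<open>foldr\<close> lets the last letter of a word act first, so that concatenation
  becomes composition in the order of the product. The coefficients act through \<iota>, which
  allows polynomials over the smaller ring to act on a module over the larger one.\<close>

definition eval_free ::
    "('g \<Rightarrow> ('s \<Rightarrow>\<^sub>0 'c) \<Rightarrow> 's \<Rightarrow>\<^sub>0 'c) \<Rightarrow> ('g free_word \<Rightarrow>\<^sub>0 'r) \<Rightarrow> ('s \<Rightarrow>\<^sub>0 'c) \<Rightarrow> 's \<Rightarrow>\<^sub>0 'c" where
  "eval_free act f v =
     (\<Sum>w\<in>Poly_Mapping.keys f. scale (\<iota> (Poly_Mapping.lookup f w)) (foldr act (letters w) v))"

lemma eval_free_add: "eval_free act (f + g) v = eval_free act f v + eval_free act g v"
  unfolding eval_free_def by (rule sum_scale_keys_plus) (simp_all add: hom_zero hom_add)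

lemma eval_free_single:
  "eval_free act (Poly_Mapping.single w c) v = scale (\<iota> c) (foldr act (letters w) v)"
  by (cases "c = 0") (simp_all add: eval_free_def hom_zero)

lemma eval_free_zero: "eval_free act 0 v = 0"
  by (simp add: eval_free_def)

lemma eval_free_diff: "eval_free act (f - g) v = eval_free act f v - eval_free act g v"
  using eval_free_add[of act "f - g" g v] by simp

lemma eval_free_sum: "eval_free act (sum f I) v = (\<Sum>i\<in>I. eval_free act (f i) v)"
  by (induction I rule: infinite_finite_induct) (simp_all add: eval_free_zero eval_free_add)

lemma eval_free_letter [simp]: "eval_free act (letter g) v = act g v"
  by (simp add: letter_def eval_free_single hom_one)

lemma eval_free_scalar: "eval_free act (scalar c) v = scale (\<iota> c) v"
  by (simp add: scalar_def eval_free_single zero_free_word_def)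

lemma eval_free_one [simp]: "eval_free act 1 v = v"
  using eval_free_scalar[of act 1 v] by (simp add: scalar_def hom_one)

lemma linear_op_eval_free:
  assumes "\<And>g. linear_op (act g)"
  shows "linear_op (eval_free act f)"
proof -
  have "linear_op (foldr act gs)" for gs
    using assms linear_op_id by (induction gs) (simp_all add: linear_op_def)
  then show ?thesis
    unfolding eval_free_def[abs_def] by (intro linear_op_sum_scale)
qed

text \<open>Both sides are additive in \<open>f\<close> and in \<open>g\<close>, which leaves single
  words. Linearity of the letters is needed to move the coefficient of the inner word past the outer
  word.\<close>

lemma eval_free_mult:
  assumes lin: "\<And>g. linear_op (act g)"
  shows "eval_free act (f * g) v = eval_free act f (eval_free act g v)"
proof (induction f rule: poly_mapping_single_induct)
  case (single w c)
  have lin_w: "linear_op (foldr act gs)" for gs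
    using lin linear_op_id by (induction gs) (simp_all add: linear_op_def)
  show ?case
  proof (induction g rule: poly_mapping_single_induct)
    case (single w' c')
    show ?case
      by (simp add: mult_single eval_free_single plus_free_word_def hom_mult linear_op_scale[OF lin_w])
  next
    case (sum f g)
    then show ?case
      by (simp add: distrib_left eval_free_add linear_op_add[OF linear_op_eval_free[OF lin]])
  qed
qed (simp add: distrib_right eval_free_add)

end

section \<open>Presented algebras and their representations\<close>

lemma quotient_algebra_simps:
  "carrier (quotient_algebra A I) = carrier (A Quot I)"
  "x \<otimes>\<^bsub>quotient_algebra A I\<^esub> y = x \<otimes>\<^bsub>A Quot I\<^esub> y"
  "x \<oplus>\<^bsub>quotient_algebra A I\<^esub> y = x \<oplus>\<^bsub>A Quot I\<^esub> y"
  "\<one>\<^bsub>quotient_algebra A I\<^esub> = \<one>\<^bsub>A Quot I\<^esub>"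
  "\<zero>\<^bsub>quotient_algebra A I\<^esub> = \<zero>\<^bsub>A Quot I\<^esub>"
  "c \<odot>\<^bsub>quotient_algebra A I\<^esub> X = (\<Union>x\<in>X. I +>\<^bsub>A\<^esub> (c \<odot>\<^bsub>A\<^esub> x))"
  by (simp_all add: quotient_algebra_def ring.defs module.defs)

lemma ring_quotient_algebra:
  assumes "ideal I A"
  shows "ring (quotient_algebra A I)"
proof -
  interpret Q: ring "A Quot I"
    using assms by (rule ideal.quotient_is_ring)
  show ?thesis
  proof (rule ringI)
    show "abelian_group (quotient_algebra A I)"
      by (rule abelian_groupI)
        (auto simp: quotient_algebra_simps Q.a_ac intro!: Q.add.l_inv_ex)
    show "Group.monoid (quotient_algebra A I)"
      by (rule monoidI) (simp_all add: quotient_algebra_simps Q.m_assoc)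
  qed (simp_all add: quotient_algebra_simps Q.l_distr Q.r_distr)
qed

text \<open>The scalar action on the quotient is a union over all representatives. It collapses to
  one coset because scaling is left multiplication by \<open>scalar c\<close>, under which the ideal
  is stable.\<close>

lemma (in coefficients) quotient_smult_coset:
  assumes "ideal I (free_algebra C G)" "c \<in> C" "f \<in> carrier (free_algebra C G)"
  shows "c \<odot>\<^bsub>quotient_algebra (free_algebra C G) I\<^esub> (I +>\<^bsub>free_algebra C G\<^esub> f) =
    I +>\<^bsub>free_algebra C G\<^esub> (scale c f)"
proof -
  let ?A = "free_algebra C G"
  interpret I: ideal I ?A by fact
  have scale_closed: "scale c g \<in> carrier ?A" if "g \<in> carrier ?A" for g
    using that assms(2) by (simp add: free_algebra_simps free_module_scale_closed)
  have "I +>\<^bsub>?A\<^esub> scale c g = I +>\<^bsub>?A\<^esub> scale c f" if g: "g \<in> I +>\<^bsub>?A\<^esub> f" for g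
  proof -
    obtain i where i: "i \<in> I" "g = i + f"
      using g by (auto simp: a_r_coset_def' free_algebra_simps)
    have "scalar c * i \<in> I"
      using I.I_l_closed[OF i(1) scalar_closed[OF assms(2)]] by (simp add: free_algebra_simps)
    then have "scale c g \<in> I +>\<^bsub>?A\<^esub> scale c f"
      using i(2) by (auto simp: a_r_coset_def' free_algebra_simps scalar_mult scale_add_right)
    then show ?thesis
      using I.a_repr_independence scale_closed[OF assms(3)] I.a_subgroup by metis
  qed
  moreover have "f \<in> I +>\<^bsub>?A\<^esub> f"
    using assms(3) by (rule I.a_rcos_self)
  ultimately show ?thesis
    unfolding quotient_algebra_simps free_algebra_simps by blast
qed

locale scalar_extension = R: coefficients C + F: coefficients D + coefficient_hom \<iota>
  for C :: "'r::comm_ring_1 set" and D :: "'c::comm_ring_1 set" and \<iota> :: "'r \<Rightarrow> 'c" +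
  assumes hom_mem: "c \<in> C \<Longrightarrow> \<iota> c \<in> D"
begin

lemma eval_free_closed:
  assumes "\<And>g v. g \<in> G \<Longrightarrow> v \<in> carrier (free_module D S) \<Longrightarrow> act g v \<in> carrier (free_module D S)"
    and "f \<in> carrier (free_algebra C G)" "v \<in> carrier (free_module D S)"
  shows "eval_free act f v \<in> carrier (free_module D S)"
proof -
  have "foldr act gs v \<in> carrier (free_module D S)" if "set gs \<subseteq> G" for gs
    using that by (induction gs) (simp_all add: assms(1,3))
  then show ?thesis
    using assms(2) unfolding eval_free_def
    by (intro F.free_module_sum_closed F.free_module_scale_closed hom_mem)
      (auto simp: R.free_algebra_simps R.free_module_simps)
qed

lemma eval_free_scale: "eval_free act (scale c f) v = scale (\<iota> c) (eval_free act f v)"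
proof (induction f rule: poly_mapping_single_induct)
  case (single k x)
  have "scale c (Poly_Mapping.single k x) = Poly_Mapping.single k (c * x)"
    by (rule poly_mapping_eqI) (simp add: lookup_scale lookup_single when_def)
  then show ?case
    by (simp add: eval_free_single hom_mult)
qed (simp add: scale_add_right eval_free_add)

text \<open>Linearity of the operators is asked on the ambient type, but closure and relations only
  on \<open>M\<close>: every evaluated polynomial is restricted to \<open>M\<close> before it is
  read as an endomorphism. The relators then lie in the kernel of a ring homomorphism, and so does
  the ideal they generate.\<close>

proposition presented_algebra_representation:
  fixes S :: "'s set"
  defines "M \<equiv> free_module D S"
  assumes lin: "\<And>g. linear_op (act g)"
    and closed: "\<And>g v. g \<in> G \<Longrightarrow> v \<in> carrier M \<Longrightarrow> act g v \<in> carrier M"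
    and U: "U \<subseteq> carrier (free_algebra C G)"
    and relations: "\<And>u v. u \<in> U \<Longrightarrow> v \<in> carrier M \<Longrightarrow> eval_free act u v = 0"
  defines "I \<equiv> genideal (free_algebra C G) U"
  defines "A \<equiv> quotient_algebra (free_algebra C G) I"
  shows "\<exists>\<rho> \<in> representations (ring_on D) (base_change (ring_on C) \<iota> (ring_on D) A) M.
    \<forall>g \<in> G. \<forall>v \<in> carrier M.
      \<rho> (pure_tensor (ring_on C) \<iota> (ring_on D) A 1 (I +>\<^bsub>free_algebra C G\<^esub> letter g)) v = act g v"
proof -
  let ?A = "free_algebra C G"
  interpret FA: ring ?A by (rule R.ring_free_algebra)
  interpret M: module "ring_on D" M
    unfolding M_def by (rule F.module_free_module)
  interpret E: ring M.E by (rule M.ring_End)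
  define h where "h f = restrict (eval_free act f) (carrier M)" for f
  note lin_eval = linear_op_eval_free[OF lin]
  have eval_closed: "eval_free act f v \<in> carrier M" if "f \<in> carrier ?A" "v \<in> carrier M" for f v
    using that closed unfolding M_def by (intro eval_free_closed)
  have M_simps: "u \<oplus>\<^bsub>M\<^esub> v = u + v" "c \<odot>\<^bsub>M\<^esub> v = scale c v" "\<zero>\<^bsub>M\<^esub> = 0" for u v c
    by (simp_all add: M_def F.free_module_simps)
  interpret h: ring_hom_ring ?A M.E h
  proof (intro ring_hom_ringI2 ring_hom_memI FA.ring_axioms E.ring_axioms)
    fix f assume f: "f \<in> carrier ?A"
    then show "h f \<in> carrier M.E"
      unfolding h_def
      by (intro M.End_memI)
        (simp_all add: eval_closed M_simps linear_op_add[OF lin_eval] linear_op_scale[OF lin_eval])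
    fix g assume g: "g \<in> carrier ?A"
    show "h (f \<otimes>\<^bsub>?A\<^esub> g) = h f \<otimes>\<^bsub>M.E\<^esub> h g"
      using f g by (simp add: h_def End_algebra_simps R.free_algebra_simps compose_def
          eval_closed eval_free_mult[OF lin] cong: restrict_cong)
    show "h (f \<oplus>\<^bsub>?A\<^esub> g) = h f \<oplus>\<^bsub>M.E\<^esub> h g"
      by (simp add: h_def End_algebra_simps R.free_algebra_simps M_simps eval_free_add
          cong: restrict_cong)
  next
    show "h \<one>\<^bsub>?A\<^esub> = \<one>\<^bsub>M.E\<^esub>"
      by (simp add: h_def End_algebra_simps R.free_algebra_simps cong: restrict_cong)
  qed
  have "h u = \<zero>\<^bsub>M.E\<^esub>" if "u \<in> U" for u
    using that by (simp add: h_def End_algebra_simps M_simps relations cong: restrict_cong)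
  with U have ker: "I \<subseteq> a_kernel ?A M.E h"
    unfolding I_def by (rule h.genideal_subset_a_kernel)
  have ideal: "ideal I ?A"
    unfolding I_def using U by (rule FA.genideal_ideal)
  interpret I: ideal I ?A by (rule ideal)
  note coset = h.induced_hom_coset[OF ideal ker]
  have A_rep: "\<exists>f \<in> carrier ?A. a = I +>\<^bsub>?A\<^esub> f" if "a \<in> carrier A" for a
    using that by (auto simp: A_def quotient_algebra_simps FactRing_simps)
  have A_coset: "I +>\<^bsub>?A\<^esub> f \<in> carrier A" if "f \<in> carrier ?A" for f
    using that ring_hom_closed[OF I.rcos_ring_hom] by (simp add: A_def quotient_algebra_simps)
  have smult_coset: "c \<odot>\<^bsub>A\<^esub> (I +>\<^bsub>?A\<^esub> f) = I +>\<^bsub>?A\<^esub> scale c f" if "c \<in> C" "f \<in> carrier ?A" for c f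
    unfolding A_def by (rule R.quotient_smult_coset[OF ideal that])
  have scale_closed: "scale c f \<in> carrier ?A" if "c \<in> C" "f \<in> carrier ?A" for c f
    using that by (simp add: R.free_algebra_simps R.free_module_scale_closed)
  interpret ring_extension "ring_on D" A
    unfolding ring_extension_def A_def
    by (intro conjI ring_quotient_algebra ideal cring.axioms(1) F.cring_ring_on)
  have "\<exists>\<rho> \<in> representations (ring_on D) (base_change (ring_on C) \<iota> (ring_on D) A) M.
    \<forall>a \<in> carrier A. \<rho> (pure_tensor (ring_on C) \<iota> (ring_on D) A \<one>\<^bsub>ring_on D\<^esub> a) = induced_hom h a"
  proof (rule base_change_representation)
    show "module (ring_on D) M" ..
    show "induced_hom h \<in> ring_hom A (End_algebra (ring_on D) M)"
      using h.induced_hom_ring_hom[OF ideal ker]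
      by (simp add: ring_hom_def A_def quotient_algebra_simps)
  next
    fix r a assume r: "r \<in> carrier (ring_on C)" and "a \<in> carrier A"
    then obtain f where f: "f \<in> carrier ?A" "a = I +>\<^bsub>?A\<^esub> f"
      using A_rep by blast
    from r have "r \<in> C"
      by (simp add: ring_on_def)
    then show "r \<odot>\<^bsub>A\<^esub> a \<in> carrier A"
      using f by (simp add: smult_coset A_coset scale_closed)
    show "induced_hom h (r \<odot>\<^bsub>A\<^esub> a) = \<iota> r \<odot>\<^bsub>End_algebra (ring_on D) M\<^esub> induced_hom h a"
      using f \<open>r \<in> C\<close>
      by (simp add: smult_coset coset scale_closed h_def End_algebra_simps M_simps eval_free_scale
          cong: restrict_cong)
  next
    show "\<iota> r \<in> carrier (ring_on D)" if "r \<in> carrier (ring_on C)" for r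
      using that hom_mem by (simp add: ring_on_def)
  qed
  then obtain \<rho> where "\<rho> \<in> representations (ring_on D) (base_change (ring_on C) \<iota> (ring_on D) A) M"
    and \<rho>: "\<And>a. a \<in> carrier A \<Longrightarrow>
      \<rho> (pure_tensor (ring_on C) \<iota> (ring_on D) A \<one>\<^bsub>ring_on D\<^esub> a) = induced_hom h a"
    by blast
  moreover have "\<rho> (pure_tensor (ring_on C) \<iota> (ring_on D) A 1 (I +>\<^bsub>?A\<^esub> letter g)) v = act g v"
    if "g \<in> G" "v \<in> carrier M" for g v
    using that \<rho>[OF A_coset[OF R.letter_closed[OF that(1)]]]
    by (simp add: coset R.letter_closed h_def ring_on_def)
  ultimately show ?thesis
    by blast
qed

end

section \<open>Laurent polynomials and their fractions\<close>

lemma coefficients_R_ring: "coefficients (carrier (R_ring m))"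
proof
  fix f g assume fg: "f \<in> carrier (R_ring m)" "g \<in> carrier (R_ring m)"
  show "f + g \<in> carrier (R_ring m)"
    using fg keys_add[of f g] by (auto simp: R_ring_def ring_on_def)
  have "Poly_Mapping.keys e \<subseteq> {0..m}" if e: "e \<in> Poly_Mapping.keys (f * g)" for e
  proof -
    obtain a b where "a \<in> Poly_Mapping.keys f" "b \<in> Poly_Mapping.keys g" "e = a + b"
      using keys_mult[of f g] e by blast
    with fg show ?thesis
      using keys_add[of a b] by (fastforce simp: R_ring_def ring_on_def)
  qed
  then show "f * g \<in> carrier (R_ring m)"
    by (simp add: R_ring_def ring_on_def)
qed (auto simp: R_ring_def ring_on_def)

interpretation R: coefficients "carrier (R_ring m)" for m
  by (rule coefficients_R_ring)

lemma carrier_F_ring: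
  "carrier (F_ring m) =
     {Fract a b | a b. a \<in> carrier (R_ring m) \<and> b \<in> carrier (R_ring m) \<and> b \<noteq> 0}"
  by (simp add: F_ring_def ring_on_def)

lemma F_ring_inverse_mem: 
  assumes "x \<in> carrier (F_ring m)"
  shows "inverse x \<in> carrier (F_ring m)"
proof -
  from assms obtain a b where x: "x = Fract a b" "a \<in> carrier (R_ring m)" "b \<in> carrier (R_ring m)" "b \<noteq> 0"
    by (auto simp: carrier_F_ring)
  then have "inverse x \<in> carrier (F_ring m)" if "a \<noteq> 0"
    using that by (auto simp: carrier_F_ring)
  \<comment> \<open>Here \<open>x\<close> is 0, and the inverse of 0 is 0 by convention.\<close>
  moreover have "inverse x = x" if "a = 0"
    using that x by (simp add: fract_collapse)
  ultimately show ?thesis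
    using assms by metis
qed

lemma fract_of_mem: "a \<in> carrier (R_ring m) \<Longrightarrow> fract_of a \<in> carrier (F_ring m)"
  unfolding carrier_F_ring fract_of_def
  by (rule CollectI, rule exI[of _ a], rule exI[of _ 1]) (simp add: R.one_mem)

interpretation fract_of: coefficient_hom fract_of
  by unfold_locales (simp_all add: fract_of_def Zero_fract_def One_fract_def)

lemma fract_of_eq_iff [simp]: "fract_of a = fract_of b \<longleftrightarrow> a = b"
  by (simp add: fract_of_def eq_fract)

lemma fract_of_diff: "fract_of (a - b) = fract_of a - fract_of b"
  by (simp add: fract_of_def)

lemma coefficients_F_ring: "coefficients (carrier (F_ring m))"
proof
  show "0 \<in> carrier (F_ring m)"
    using fract_of_mem[OF R.zero_mem] by (simp add: fract_of.hom_zero)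
  show "1 \<in> carrier (F_ring m)"
    using fract_of_mem[OF R.one_mem] by (simp add: fract_of.hom_one)
next
  fix x y assume "x \<in> carrier (F_ring m)" "y \<in> carrier (F_ring m)"
  then obtain a b c d where x: "x = Fract a b" "a \<in> carrier (R_ring m)" "b \<in> carrier (R_ring m)" "b \<noteq> 0"
    and y: "y = Fract c d" "c \<in> carrier (R_ring m)" "d \<in> carrier (R_ring m)" "d \<noteq> 0"
    by (auto simp: carrier_F_ring)
  then have "a * d + c * b \<in> carrier (R_ring m)" "a * c \<in> carrier (R_ring m)"
    "b * d \<in> carrier (R_ring m)" "b * d \<noteq> 0" "- a \<in> carrier (R_ring m)"
    by (simp_all add: R.add_mem R.mult_mem R.uminus_mem)
  then show "x + y \<in> carrier (F_ring m)" "x * y \<in> carrier (F_ring m)" "- x \<in> carrier (F_ring m)"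
    using x y unfolding carrier_F_ring x(1) y(1) add_fract[OF x(4) y(4)] mult_fract minus_fract by blast+
qed

interpretation F: coefficients "carrier (F_ring m)" for m
  by (rule coefficients_F_ring)

interpretation RF: scalar_extension "carrier (R_ring m)" "carrier (F_ring m)" fract_of for m
  by unfold_locales (rule fract_of_mem)

lemma ring_on_R_ring: "ring_on (carrier (R_ring m)) = R_ring m"
  and ring_on_F_ring: "ring_on (carrier (F_ring m)) = F_ring m"
  by (simp_all add: R_ring_def F_ring_def ring_on_def)

lemma F_ring_diff_mem: "x \<in> carrier (F_ring m) \<Longrightarrow> y \<in> carrier (F_ring m) \<Longrightarrow> x - y \<in> carrier (F_ring m)"
  using F.add_mem[OF _ F.uminus_mem] by simp

lemma F_ring_divide_mem: "x \<in> carrier (F_ring m) \<Longrightarrow> y \<in> carrier (F_ring m) \<Longrightarrow> x / y \<in> carrier (F_ring m)"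
  unfolding divide_inverse by (intro F.mult_mem F_ring_inverse_mem)

lemma laurent_const_mem: "laurent_const z \<in> carrier (R_ring m)"
  by (auto simp: laurent_const_def R_ring_def ring_on_def)

lemma indet_powi_mem: "l \<le> m \<Longrightarrow> indet_powi l k \<in> carrier (R_ring m)"
  by (auto simp: indet_powi_def R_ring_def ring_on_def)

interpretation const: coefficient_hom "\<lambda>z. fract_of (laurent_const z)"
  by unfold_locales
    (simp_all add: laurent_const_def single_add mult_single fract_of.hom_zero fract_of.hom_one
      flip: fract_of.hom_add fract_of.hom_mult)

lemma const_sum:
  "fract_of (laurent_const (sum f I)) = (\<Sum>i\<in>I. fract_of (laurent_const (f i)))"
  by (induction I rule: infinite_finite_induct) (simp_all add: const.hom_zero const.hom_add)

lemma indet_powi_add: "indet_powi l (j + k) = indet_powi l j * indet_powi l k"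
  by (simp add: indet_powi_def mult_single single_add)

lemma single_nonzero: "v \<noteq> 0 \<Longrightarrow> Poly_Mapping.single k v \<noteq> 0"
  by (metis lookup_single_eq lookup_zero)

lemma qF_nonzero: "qF \<noteq> 0"
  using fract_of_eq_iff[of "indet_powi 0 1" 0] by (simp add: qF_def fract_of.hom_zero indet_powi_def single_nonzero)

lemma qF_powi: "qF powi k = fract_of (indet_powi 0 k)"
proof -
  have nat: "qF ^ j = fract_of (indet_powi 0 (int j))" for j
  proof (induction j)
    case 0
    show ?case by (simp add: indet_powi_def fract_of.hom_one)
  next
    case (Suc j)
    then show ?case
      using indet_powi_add[of 0 1 "int j"] by (simp add: qF_def fract_of.hom_mult)
  qed
  show ?thesis
  proof (cases "k \<ge> 0")
    case True
    then show ?thesis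
      using nat[of "nat k"] by (simp add: power_int_def)
  next
    case False
    have "fract_of (indet_powi 0 (- k)) * fract_of (indet_powi 0 k) = 1"
      using indet_powi_add[of 0 "- k" k]
      by (simp add: indet_powi_def fract_of.hom_one flip: fract_of.hom_mult)
    with False show ?thesis
      using nat[of "nat (- k)"] by (simp add: power_int_def inverse_unique power_inverse)
  qed
qed

lemma qF_minus_inverse: "fract_of (indet_powi 0 1 - indet_powi 0 (- 1)) = qF - inverse qF"
  using qF_powi[of "- 1"] by (simp add: fract_of_diff qF_def)

lemma qF_mem: "qF \<in> carrier (F_ring m)"
  unfolding qF_def by (intro fract_of_mem indet_powi_mem) simp

text \<open>With the content written as a single Laurent monomial, equality of contents becomes
  equality of exponent vectors, and no computation with fractions is needed.\<close>

lemma qcontent_monomial: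
  "qcontent ((x, y), k, l) = fract_of (Poly_Mapping.single
     (Poly_Mapping.single l 1 + Poly_Mapping.single 0 (2 * (int y - int x))) 1)"
  by (simp add: vF_def qF_powi indet_powi_def mult_single flip: fract_of.hom_mult)

lemma qcontent_eq_iff:
  assumes "l \<noteq> 0" "l' \<noteq> 0"
  shows "qcontent ((x, y), k, l) = qcontent ((x', y'), k', l') \<longleftrightarrow>
    l = l' \<and> int y - int x = int y' - int x'"
proof
  assume "qcontent ((x, y), k, l) = qcontent ((x', y'), k', l')"
  then have eq: "Poly_Mapping.single l 1 + Poly_Mapping.single 0 (2 * (int y - int x)) =
      Poly_Mapping.single l' 1 + Poly_Mapping.single 0 (2 * (int y' - int x'))"
    unfolding qcontent_monomial fract_of_eq_iff by (metis keys_single singleton_inject zero_neq_one)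
  from eq have "Poly_Mapping.lookup (Poly_Mapping.single l 1 + Poly_Mapping.single 0 (2 * (int y - int x))) i =
      Poly_Mapping.lookup (Poly_Mapping.single l' 1 + Poly_Mapping.single 0 (2 * (int y' - int x'))) i" for i
    by simp
  \<comment> \<open>Index 0 belongs to \<open>q\<close>: since \<open>l\<close> and
    \<open>l'\<close> are nonzero, comparison there gives twice the two diagonals. At index
    \<open>l\<close> the left vector has entry 1, which forces \<open>l = l'\<close>.\<close>
  from this[of 0] this[of l] assms show "l = l' \<and> int y - int x = int y' - int x'"
    by (simp add: lookup_add lookup_single when_def split: if_splits)
qed auto

lemma qcontent_nonzero: "qcontent \<theta> \<noteq> 0"
proof (cases \<theta> rule: qcontent.cases)
  case (1 x y k l)
  then show ?thesis
    unfolding 1 qcontent_monomial using fract_of_eq_iff[of _ 0] by (simp add: fract_of.hom_zero single_nonzero)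
qed

lemma qcontent_mem:
  assumes "l \<le> m"
  shows "qcontent ((x, y), k, l) \<in> carrier (F_ring m)"
  unfolding qcontent.simps vF_def qF_powi
  by (intro F.mult_mem fract_of_mem indet_powi_mem) (use assms in auto)

section \<open>Standard tableaux\<close>

lemma dm_nodes_iff:
  "((x, y), k, l) \<in> dm_nodes \<Lambda> \<longleftrightarrow>
     k \<in> {1..length \<Lambda>} \<and> l \<in> {1..length (\<Lambda> ! (k - 1))} \<and>
     x \<in> {1..length (\<Lambda> ! (k - 1) ! (l - 1))} \<and>
     y \<in> {1..\<Lambda> ! (k - 1) ! (l - 1) ! (x - 1)}"
  by (simp add: dm_nodes_def)

lemma dm_nodes_down_closed:
  assumes "\<Lambda> \<in> dm_partitions d m n" "((x', y'), k, l) \<in> dm_nodes \<Lambda>"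
    and "1 \<le> x" "x \<le> x'" "1 \<le> y" "y \<le> y'"
  shows "((x, y), k, l) \<in> dm_nodes \<Lambda>"
proof -
  let ?p = "\<Lambda> ! (k - 1) ! (l - 1)"
  have kl: "k \<in> {1..length \<Lambda>}" "l \<in> {1..length (\<Lambda> ! (k - 1))}" "x' \<in> {1..length ?p}" "y' \<le> ?p ! (x' - 1)"
    using assms(2) by (simp_all add: dm_nodes_iff)
  then have "\<Lambda> ! (k - 1) \<in> set \<Lambda>" "?p \<in> set (\<Lambda> ! (k - 1))"
    by auto
  then have "sorted_wrt (\<ge>) ?p"
    using assms(1) by (auto simp: dm_partitions_def is_partition_def)
  then have "?p ! (x' - 1) \<le> ?p ! (x - 1)"
    using sorted_wrt_nth_less[of "(\<ge>)" ?p "x - 1" "x' - 1"] assms(3,4) kl(3)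
    by (cases "x = x'") auto
  then show ?thesis
    using kl assms(3-) by (simp add: dm_nodes_iff)
qed

lemma dm_nodes_bounds:
  assumes "\<Lambda> \<in> dm_partitions d m n" "((x, y), k, l) \<in> dm_nodes \<Lambda>"
  shows "k \<in> {1..d}" "l \<in> {1..m}" "1 \<le> x" "1 \<le> y"
proof -
  have "k \<in> {1..length \<Lambda>}" "l \<in> {1..length (\<Lambda> ! (k - 1))}" "1 \<le> x" "1 \<le> y"
    using assms(2) by (simp_all add: dm_nodes_iff)
  moreover from this have "\<Lambda> ! (k - 1) \<in> set \<Lambda>"
    by auto
  ultimately show "k \<in> {1..d}" "l \<in> {1..m}" "1 \<le> x" "1 \<le> y"
    using assms(1) by (auto simp: dm_partitions_def)
qed

text \<open>The obstruction to exchanging consecutive entries, by \<open>swap_standard_iff\<close>.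
  It is symmetric because either node may hold the smaller entry.\<close>

fun adjacent :: "dm_node \<Rightarrow> dm_node \<Rightarrow> bool" where
  "adjacent ((x, y), k, l) ((x', y'), k', l') \<longleftrightarrow> k = k' \<and> l = l' \<and>
     (x = x' \<and> (y' = Suc y \<or> y = Suc y') \<or> y = y' \<and> (x' = Suc x \<or> x = Suc x'))"

lemma adjacent_commute: "adjacent \<theta> \<theta>' \<longleftrightarrow> adjacent \<theta>' \<theta>"
  by (cases "(\<theta>, \<theta>')" rule: adjacent.cases) auto

lemma adjacent_node_pos: "adjacent \<theta> \<theta>' \<Longrightarrow> node_pos \<theta> = node_pos \<theta>'"
  by (cases "(\<theta>, \<theta>')" rule: adjacent.cases) auto

text \<open>Neighbouring nodes lie on neighbouring diagonals, and the factor 2 in the exponent of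
  the content turns one step into \<open>q^2\<close>. At this ratio one of the two numerators in
  \<open>swap_coeff\<close> vanishes.\<close>

lemma adjacent_qcontent:
  assumes "adjacent \<theta> \<theta>'"
  shows "qcontent \<theta>' = qF\<^sup>2 * qcontent \<theta> \<or> qcontent \<theta> = qF\<^sup>2 * qcontent \<theta>'"
proof -
  have step: "qF powi (2 * (a + 1)) = qF\<^sup>2 * qF powi (2 * a)" for a
    using power_int_add[of qF "2 * a" 2] qF_nonzero by (simp add: algebra_simps)
  show ?thesis
  proof (cases "(\<theta>, \<theta>')" rule: adjacent.cases)
    case (1 x y k l x' y' k' l')
    then have "l = l'" and "int y' - int x' = int y - int x + 1 \<or> int y - int x = int y' - int x' + 1"
      using assms by auto
    then show ?thesis
    proof (elim disjE, goal_cases)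
      case A: 1
      have "qcontent \<theta>' = qF\<^sup>2 * qcontent \<theta>"
        using 1 \<open>l = l'\<close> by (simp only: prod.inject qcontent.simps A(2) step mult.left_commute)
      then show ?case ..
    next
      case A: 2
      have "qcontent \<theta> = qF\<^sup>2 * qcontent \<theta>'"
        using 1 \<open>l = l'\<close> by (simp only: prod.inject qcontent.simps A(2) step mult.left_commute)
      then show ?case ..
    qed
  qed
qed

section \<open>Order of the entries in a standard tableau\<close>

locale standard_tableau =
  fixes d m n \<Lambda> T
  assumes \<Lambda>: "\<Lambda> \<in> dm_partitions d m n" and T: "T \<in> standard_tableaux n \<Lambda>"
begin

lemma bij: "bij_betw T {1..n} (dm_nodes \<Lambda>)"
  using T by (simp add: standard_tableaux_def tableaux_def)

lemma entry_node: "i \<in> {1..n} \<Longrightarrow> T i \<in> dm_nodes \<Lambda>"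
  using bij by (rule bij_betwE[rule_format])

lemma node_entry: "\<theta> \<in> dm_nodes \<Lambda> \<Longrightarrow> \<exists>i \<in> {1..n}. T i = \<theta>"
  using bij by (metis bij_betw_imp_surj_on imageE)

lemma entry_eq_iff: "i \<in> {1..n} \<Longrightarrow> j \<in> {1..n} \<Longrightarrow> T i = T j \<longleftrightarrow> i = j"
  using bij by (metis bij_betw_imp_inj_on inj_on_eq_iff)

lemma entry_less_row:
  assumes "i \<in> {1..n}" "j \<in> {1..n}" "T i = ((x, y), k, l)" "T j = ((x, y'), k, l)" "y < y'"
  shows "i < j"
  using T assms unfolding standard_tableaux_def is_standard_def by blast

lemma entry_less_column:
  assumes "i \<in> {1..n}" "j \<in> {1..n}" "T i = ((x, y), k, l)" "T j = ((x', y), k, l)" "x < x'"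
  shows "i < j"
  using T assms unfolding standard_tableaux_def is_standard_def by blast

text \<open>If the nodes differ in both coordinates, the corner \<open>(x, y')\<close> of their
  rectangle belongs to the diagram, and its entry lies strictly between the two by monotonicity
  along a row and along a column.\<close>

lemma entry_less:
  assumes i: "i \<in> {1..n}" "T i = ((x, y), k, l)" and j: "j \<in> {1..n}" "T j = ((x', y'), k, l)"
    and "x \<le> x'" "y \<le> y'" "(x, y) \<noteq> (x', y')"
  shows "i < j"
proof (cases "x = x' \<or> y = y'")
  case True
  then have "x = x' \<and> y < y' \<or> y = y' \<and> x < x'"
    using assms(5-7) by auto
  then show ?thesis
    using entry_less_row[OF i(1) j(1) i(2)] entry_less_column[OF i(1) j(1) i(2)] j(2) by auto
next
  case False
  have ni: "((x, y), k, l) \<in> dm_nodes \<Lambda>" and nj: "((x', y'), k, l) \<in> dm_nodes \<Lambda>"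
    using entry_node[OF i(1)] entry_node[OF j(1)] unfolding i(2) j(2) .
  have "((x, y'), k, l) \<in> dm_nodes \<Lambda>"
    using dm_nodes_bounds(3)[OF \<Lambda> ni] assms(5) dm_nodes_bounds(4)[OF \<Lambda> nj]
    by (intro dm_nodes_down_closed[OF \<Lambda> nj]) simp_all
  then obtain c where c: "c \<in> {1..n}" "T c = ((x, y'), k, l)"
    using node_entry by blast
  have "x < x'" "y < y'"
    using False assms(5,6) by auto
  then have "i < c" "c < j"
    using entry_less_row[OF i(1) c(1) i(2) c(2)] entry_less_column[OF c(1) j(1) c(2) j(2)]
    by simp_all
  then show ?thesis by simp
qed

text \<open>Otherwise node (1, 1) of the same diagram would hold an entry below 1. Hence the content
  of entry 1 is one of the parameters of the cyclotomic relation.\<close>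

lemma first_node:
  assumes "1 \<le> n"
  obtains k l where "T 1 = ((1, 1), k, l)" "l \<in> {1..m}"
proof -
  obtain x y k l where T1: "T 1 = ((x, y), k, l)"
    by (metis surj_pair)
  have one: "1 \<in> {1..n}"
    using assms by simp
  note node = entry_node[OF one, unfolded T1]
  note bounds = dm_nodes_bounds[OF \<Lambda> node]
  have "((1, 1), k, l) \<in> dm_nodes \<Lambda>"
    using dm_nodes_down_closed[OF \<Lambda> node] bounds by simp
  then obtain c where c: "c \<in> {1..n}" "T c = ((1, 1), k, l)"
    using node_entry by blast
  have "(x, y) = (1, 1)"
    using entry_less[OF c one T1] bounds c(1) by force
  then show ?thesis
    using that T1 bounds by simp
qed

text \<open>Between two nodes on the same diagonal there are at least two further entries.\<close>

lemma qcontent_neq: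
  assumes i: "i \<in> {1..n}" and j: "j \<in> {1..n}" and "i < j" "j \<le> i + 2"
    and pos: "node_pos (T i) = node_pos (T j)"
  shows "qcontent (T i) \<noteq> qcontent (T j)"
proof
  assume eq: "qcontent (T i) = qcontent (T j)"
  obtain x y k l x' y' l' where Ti: "T i = ((x, y), k, l)" and Tj: "T j = ((x', y'), k, l')"
    using pos by (metis node_pos.simps surj_pair)
  note bi = dm_nodes_bounds[OF \<Lambda> entry_node[OF i, unfolded Ti]]
  note nj = entry_node[OF j, unfolded Tj]
  note bj = dm_nodes_bounds[OF \<Lambda> nj]
  have l: "l' = l" and diag: "int y - int x = int y' - int x'"
    using eq bi(2) bj(2) by (simp_all add: Ti Tj qcontent_eq_iff del: qcontent.simps)
  have "T i \<noteq> T j"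
    using entry_eq_iff[OF i j] \<open>i < j\<close> by simp
  then have "x \<noteq> x'"
    using diag l by (auto simp: Ti Tj)
  moreover have "\<not> x' < x"
    using entry_less[OF j _ i, of x' y' k l x y] diag l \<open>i < j\<close> by (auto simp: Ti Tj)
  ultimately have less: "x < x'" "y < y'"
    using diag by linarith+
  \<comment> \<open>The right and lower neighbours of the earlier node lie in the rectangle spanned
    by the two nodes, so each holds an entry strictly between \<open>i\<close> and
    \<open>j\<close>.\<close>
  have "((x, Suc y), k, l) \<in> dm_nodes \<Lambda>" "((Suc x, y), k, l) \<in> dm_nodes \<Lambda>"
    using less bi bj nj l by (auto intro: dm_nodes_down_closed[OF \<Lambda>])
  then obtain a b where a: "a \<in> {1..n}" "T a = ((x, Suc y), k, l)"
    and b: "b \<in> {1..n}" "T b = ((Suc x, y), k, l)"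
    using node_entry by meson
  have "i < a" "i < b" "a < j" "b < j"
    using entry_less[OF i Ti a] entry_less[OF i Ti b] less
      entry_less[OF a j Tj[unfolded l]] entry_less[OF b j Tj[unfolded l]] by simp_all
  moreover have "a \<noteq> b"
    using a b by auto
  ultimately show False
    using \<open>j \<le> i + 2\<close> by linarith
qed

abbreviation "swap i \<equiv> T \<circ> Transposition.transpose i (i + 1)"

lemma swap_tableau:
  assumes "i \<in> {1..<n}"
  shows "swap i \<in> tableaux n \<Lambda>"
proof -
  have "Transposition.transpose i (i + 1) permutes {1..n}"
    using assms by (intro permutes_swap_id) auto
  then have "bij_betw (swap i) {1..n} (dm_nodes \<Lambda>)"
    by (rule bij_betw_trans[OF permutes_imp_bij bij])
  moreover have "swap i \<in> extensional {1..n}"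
    using T assms by (auto simp: standard_tableaux_def tableaux_def extensional_def transpose_def)
  ultimately show ?thesis
    by (simp add: tableaux_def)
qed

text \<open>A gap in the row would contain a node whose entry lies strictly between \<open>i\<close>
  and \<open>i + 1\<close>.\<close>

lemma adjacentI_row:
  assumes "i \<in> {1..<n}" "T i = ((x, y), k, l)" "T (i + 1) = ((x, y'), k, l)" "y < y'"
  shows "adjacent (T i) (T (i + 1))"
proof (rule ccontr)
  assume "\<not> adjacent (T i) (T (i + 1))"
  then have "Suc y < y'"
    using assms by simp
  have i: "i \<in> {1..n}" "i + 1 \<in> {1..n}"
    using assms(1) by auto
  have "((x, Suc y), k, l) \<in> dm_nodes \<Lambda>"
    using dm_nodes_down_closed[OF \<Lambda> entry_node[OF i(2), unfolded assms(3)], of x "Suc y"]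
      dm_nodes_bounds[OF \<Lambda> entry_node[OF i(1), unfolded assms(2)]] \<open>Suc y < y'\<close> by simp
  then obtain c where c: "c \<in> {1..n}" "T c = ((x, Suc y), k, l)"
    using node_entry by blast
  have "i < c" "c < i + 1"
    using entry_less_row[OF i(1) c(1) assms(2) c(2)] entry_less_row[OF c(1) i(2) c(2) assms(3)]
      \<open>Suc y < y'\<close> by simp_all
  then show False by simp
qed

lemma adjacentI_column:
  assumes "i \<in> {1..<n}" "T i = ((x, y), k, l)" "T (i + 1) = ((x', y), k, l)" "x < x'"
  shows "adjacent (T i) (T (i + 1))"
proof (rule ccontr)
  assume "\<not> adjacent (T i) (T (i + 1))"
  then have "Suc x < x'"
    using assms by simp
  have i: "i \<in> {1..n}" "i + 1 \<in> {1..n}"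
    using assms(1) by auto
  have "((Suc x, y), k, l) \<in> dm_nodes \<Lambda>"
    using dm_nodes_down_closed[OF \<Lambda> entry_node[OF i(2), unfolded assms(3)], of "Suc x" y]
      dm_nodes_bounds[OF \<Lambda> entry_node[OF i(1), unfolded assms(2)]] \<open>Suc x < x'\<close> by simp
  then obtain c where c: "c \<in> {1..n}" "T c = ((Suc x, y), k, l)"
    using node_entry by blast
  have "i < c" "c < i + 1"
    using entry_less_column[OF i(1) c(1) assms(2) c(2)] entry_less_column[OF c(1) i(2) c(2) assms(3)]
      \<open>Suc x < x'\<close> by simp_all
  then show False by simp
qed

lemma swap_standard_iff:
  assumes i: "i \<in> {1..<n}"
  shows "swap i \<in> standard_tableaux n \<Lambda> \<longleftrightarrow> \<not> adjacent (T i) (T (i + 1))"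
proof
  assume swap: "swap i \<in> standard_tableaux n \<Lambda>"
  interpret swap: standard_tableau d m n \<Lambda> "swap i"
    using \<Lambda> swap by unfold_locales
  have mem: "i \<in> {1..n}" "i + 1 \<in> {1..n}"
    using i by auto
  show "\<not> adjacent (T i) (T (i + 1))"
  proof
    assume adj: "adjacent (T i) (T (i + 1))"
    obtain x y k l x' y' k' l' where nodes: "T i = ((x, y), k, l)" "T (i + 1) = ((x', y'), k', l')"
      by (metis surj_pair)
    then have swapped: "swap i i = ((x', y'), k', l')" "swap i (i + 1) = ((x, y), k, l)"
      by simp_all
    have kl: "k' = k" "l' = l"
      using adj nodes by auto
    have "(x, y) \<noteq> (x', y')" "x \<le> x' \<and> y \<le> y' \<or> x' \<le> x \<and> y' \<le> y"
      using adj nodes by auto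
    \<comment> \<open>\<open>entry_less\<close>, applied to \<open>T\<close> or to its swap
      according to which of the two nodes comes first, gives \<open>i + 1 < i\<close>.\<close>
    then show False
      using entry_less[OF mem(2) _ mem(1) nodes(1), of x' y'] nodes(2)
        swap.entry_less[OF mem(2) swapped(2) mem(1), of x' y'] swapped(1)
      unfolding kl by auto
  qed
next
  assume nadj: "\<not> adjacent (T i) (T (i + 1))"
  let ?s = "Transposition.transpose i (i + 1)"
  have mem: "?s a \<in> {1..n}" if "a \<in> {1..n}" for a
    using that i by (auto simp: transpose_def)
  \<comment> \<open>The transposition reverses only the pair formed by \<open>i\<close> and
    \<open>i + 1\<close>, and this pair shares no row or column of a diagram: it would then be
    adjacent.\<close>
  have order: "a < b \<or> a = i + 1 \<and> b = i" if "?s a < ?s b" for a b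
    using that by (auto simp: transpose_def split: if_splits)
  have "a < b" if "a \<in> {1..n}" "b \<in> {1..n}" "T (?s a) = ((x, y), k, l)" "T (?s b) = ((x', y'), k, l)"
    "x = x' \<and> y < y' \<or> y = y' \<and> x < x'" for a b x y x' y' k l
  proof -
    have "?s a < ?s b"
      using entry_less[OF mem[OF that(1)] that(3) mem[OF that(2)] that(4)] that(5) by auto
    moreover have "\<not> (a = i + 1 \<and> b = i)"
      using that(3-5) nadj adjacentI_row[OF i, of x y k l] adjacentI_column[OF i, of x y k l] by auto
    ultimately show ?thesis
      using order by blast
  qed
  then have "is_standard n (swap i)"
    unfolding is_standard_def o_def by blast
  then show "swap i \<in> standard_tableaux n \<Lambda>"
    using swap_tableau[OF i] by (simp add: standard_tableaux_def)
qed

end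

section \<open>The action of the generators\<close>

definition swap_entries :: "nat \<Rightarrow> dm_tableau \<Rightarrow> dm_tableau" where
  "swap_entries i T = T \<circ> Transposition.transpose i (Suc i)"

lemma apply_entries_transpose:
  "apply_entries (Transposition.transpose i (i + 1)) T = swap_entries i T"
  by (simp add: apply_entries_def swap_entries_def)

lemma swap_entries_apply [simp]:
  "swap_entries i T i = T (Suc i)" "swap_entries i T (Suc i) = T i"
  "j \<noteq> i \<Longrightarrow> j \<noteq> Suc i \<Longrightarrow> swap_entries i T j = T j"
  by (simp_all add: swap_entries_def)

lemma swap_entries_involutory [simp]: "swap_entries i (swap_entries i T) = T"
  by (simp add: swap_entries_def o_assoc[symmetric])

lemma swap_entries_commute:
  assumes "\<bar>int i - int j\<bar> > 1"
  shows "swap_entries i (swap_entries j T) = swap_entries j (swap_entries i T)"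
  using assms by (auto simp: swap_entries_def fun_eq_iff transpose_def)

lemma swap_entries_braid:
  "swap_entries i (swap_entries (Suc i) (swap_entries i T)) =
   swap_entries (Suc i) (swap_entries i (swap_entries (Suc i) T))"
  by (auto simp: swap_entries_def fun_eq_iff transpose_def)

section \<open>Matrix coefficients of the braid generators\<close>

definition diag_coeff :: "dm_node \<Rightarrow> dm_node \<Rightarrow> laurent fract" where
  "diag_coeff \<theta> \<theta>' = (if node_pos \<theta> = node_pos \<theta>'
     then qcontent \<theta>' * (qF - inverse qF) / (qcontent \<theta>' - qcontent \<theta>) else 0)"

text \<open>
  The formula for this coefficient vanishes for only one of the two orders of adjacent nodes. Setting
  it to 0 for both amounts to setting the basis vectors of non-standard tableaux to 0, and makes the
  span of the standard tableaux invariant.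
\<close>

definition swap_coeff :: "dm_node \<Rightarrow> dm_node \<Rightarrow> laurent fract" where
  "swap_coeff \<theta> \<theta>' = (if node_pos \<theta> \<noteq> node_pos \<theta>' then 1 else if adjacent \<theta> \<theta>' then 0
     else (qF * qcontent \<theta>' - inverse qF * qcontent \<theta>) / (qcontent \<theta>' - qcontent \<theta>))"

text \<open>This is precisely nonvanishing of the denominators, empty at different positions. The
  identities below depend on it alone, so they apply to nodes without reference to a
  tableau.\<close>

definition generic_pair :: "dm_node \<Rightarrow> dm_node \<Rightarrow> bool" where
  "generic_pair \<theta> \<theta>' \<longleftrightarrow> (node_pos \<theta> = node_pos \<theta>' \<longrightarrow> qcontent \<theta> \<noteq> qcontent \<theta>')"

lemma diag_coeff_eq:
  assumes "generic_pair \<theta> \<theta>'" "node_pos \<theta> = node_pos \<theta>'"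
  shows "diag_coeff \<theta> \<theta>' * (qcontent \<theta>' - qcontent \<theta>) = qcontent \<theta>' * (qF - inverse qF)"
  using assms by (simp add: diag_coeff_def generic_pair_def)

lemma generic_pair_commute: "generic_pair \<theta> \<theta>' \<longleftrightarrow> generic_pair \<theta>' \<theta>"
  by (auto simp: generic_pair_def)

text \<open>This is the trace of \<open>g\<^sub>i\<close> on the plane spanned by a tableau and its
  swap. The two defining fractions have opposite denominators, so they can be added at once.\<close>

lemma diag_coeff_commute:
  assumes "generic_pair \<theta> \<theta>'" "node_pos \<theta> = node_pos \<theta>'"
  shows "diag_coeff \<theta>' \<theta> = (qF - inverse qF) - diag_coeff \<theta> \<theta>'"
proof -
  have "(diag_coeff \<theta> \<theta>' + diag_coeff \<theta>' \<theta> - (qF - inverse qF)) * (qcontent \<theta>' - qcontent \<theta>) =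
      diag_coeff \<theta> \<theta>' * (qcontent \<theta>' - qcontent \<theta>) - diag_coeff \<theta>' \<theta> * (qcontent \<theta> - qcontent \<theta>')
      - (qF - inverse qF) * (qcontent \<theta>' - qcontent \<theta>)"
    by (simp add: algebra_simps)
  also have "\<dots> = 0"
    using assms diag_coeff_eq[of \<theta> \<theta>'] diag_coeff_eq[of \<theta>' \<theta>]
    by (simp add: generic_pair_commute) (simp add: algebra_simps)
  finally have "diag_coeff \<theta> \<theta>' + diag_coeff \<theta>' \<theta> - (qF - inverse qF) = 0"
    using assms unfolding mult_eq_0_iff by (simp add: generic_pair_def)
  then show ?thesis
    by Groebner_Basis.algebra
qed

text \<open>By this formula \<open>g\<^sub>i\<close> has determinant -1 on the plane spanned by a
  tableau and its swap. It expresses the product of swap coefficients through a diagonal one, so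
  that the later identities concern diagonal coefficients only.\<close>

lemma swap_coeff_mult:
  assumes "generic_pair \<theta> \<theta>'"
  shows "swap_coeff \<theta> \<theta>' * swap_coeff \<theta>' \<theta> =
    1 + (qF - inverse qF) * diag_coeff \<theta> \<theta>' - diag_coeff \<theta> \<theta>' ^ 2"
proof (cases "node_pos \<theta> = node_pos \<theta>'")
  case True
  define c c' r x where "c = qcontent \<theta>" and "c' = qcontent \<theta>'" and "r = inverse qF"
    and "x = diag_coeff \<theta> \<theta>'"
  have neq: "c' - c \<noteq> 0" "c - c' \<noteq> 0"
    using True assms by (auto simp: generic_pair_def c_def c'_def)
  have r: "qF * r = 1"
    using qF_nonzero by (simp add: r_def)
  have x: "x * (c' - c) = c' * (qF - r)"
    using diag_coeff_eq[OF assms True] by (simp add: x_def c_def c'_def r_def)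
  \<comment> \<open>After multiplication by both denominators, \<open>x\<close> occurs only within
    \<open>x * (c' - c)\<close>, whose value is known.\<close>
  have "(1 + (qF - r) * x - x ^ 2) * ((c' - c) * (c - c')) =
    (x * (c' - c)) ^ 2 - (c' - c) ^ 2 - (qF - r) * (x * (c' - c)) * (c' - c)"
    by Groebner_Basis.algebra
  also have "\<dots> = (qF * c' - r * c) * (qF * c - r * c')"
    unfolding x using r by Groebner_Basis.algebra
  finally have prod: "(1 + (qF - r) * x - x ^ 2) * ((c' - c) * (c - c')) = \<dots>" .
  have "swap_coeff \<theta> \<theta>' * swap_coeff \<theta>' \<theta> = 1 + (qF - r) * x - x ^ 2"
  proof (cases "adjacent \<theta> \<theta>'")
    case adj: True
    \<comment> \<open>The left-hand product is 0 by definition here. The right-hand side must vanish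
      too, and does, because a ratio \<open>q^2\<close> of contents annihilates one of the two
      numerators.\<close>
    have "(qF * c' - r * c) * (qF * c - r * c') = 0"
      using adjacent_qcontent[OF adj] unfolding c_def[symmetric] c'_def[symmetric]
    proof
      assume "c' = qF\<^sup>2 * c"
      then show ?thesis using r by Groebner_Basis.algebra
    next
      assume "c = qF\<^sup>2 * c'"
      then show ?thesis using r by Groebner_Basis.algebra
    qed
    with prod have "1 + (qF - r) * x - x ^ 2 = 0"
      using neq by (simp only: mult_eq_0_iff) simp
    then show ?thesis
      using adj True by (simp add: swap_coeff_def)
  next
    case False
    then have "swap_coeff \<theta> \<theta>' * swap_coeff \<theta>' \<theta> =
        (qF * c' - r * c) * (qF * c - r * c') / ((c' - c) * (c - c'))"
      using True adjacent_commute[of \<theta> \<theta>']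
      by (simp add: swap_coeff_def c_def c'_def r_def times_divide_times_eq)
    then show ?thesis
      using neq unfolding prod[symmetric] by simp
  qed
  then show ?thesis
    by (simp add: x_def r_def)
qed (simp add: swap_coeff_def diag_coeff_def)

text \<open>These compare coefficients in the braid relation for a tableau with nodes \<theta>,
  \<theta>', \<theta>'' at three consecutive entries: \<open>?R\<close> at the tableau itself,
  \<open>?P\<close> and \<open>?Q\<close> at its two simple swaps after removal of a common swap
  coefficient. For equal positions, \<open>?P\<close> implies the other two.\<close>

lemma diag_coeff_braid:
  assumes "generic_pair \<theta> \<theta>'" "generic_pair \<theta> \<theta>''" "generic_pair \<theta>' \<theta>''"
  shows "diag_coeff \<theta> \<theta>' * diag_coeff \<theta>' \<theta>'' + diag_coeff \<theta> \<theta>'' * diag_coeff \<theta>' \<theta> =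
      diag_coeff \<theta>' \<theta>'' * diag_coeff \<theta> \<theta>''" (is ?P)
    and "diag_coeff \<theta> \<theta>' * diag_coeff \<theta> \<theta>'' =
      diag_coeff \<theta>' \<theta>'' * diag_coeff \<theta> \<theta>' + diag_coeff \<theta> \<theta>'' * diag_coeff \<theta>'' \<theta>'" (is ?Q)
    and "diag_coeff \<theta> \<theta>' ^ 2 * diag_coeff \<theta>' \<theta>'' +
        swap_coeff \<theta> \<theta>' * swap_coeff \<theta>' \<theta> * diag_coeff \<theta> \<theta>'' =
      diag_coeff \<theta>' \<theta>'' ^ 2 * diag_coeff \<theta> \<theta>' +
        swap_coeff \<theta>' \<theta>'' * swap_coeff \<theta>'' \<theta>' * diag_coeff \<theta> \<theta>''" (is ?R)
proof -
  have "?P \<and> ?Q \<and> ?R"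
  proof (cases "node_pos \<theta> = node_pos \<theta>' \<and> node_pos \<theta>' = node_pos \<theta>''")
    case True
    define h where "h = qF - inverse qF"
    define a b c where "a = qcontent \<theta>" and "b = qcontent \<theta>'" and "c = qcontent \<theta>''"
    define x y z where "x = diag_coeff \<theta> \<theta>'" and "y = diag_coeff \<theta> \<theta>''" and "z = diag_coeff \<theta>' \<theta>''"
    have eqs: "x * (b - a) = b * h" "y * (c - a) = c * h" "z * (c - b) = c * h"
      using True assms by (simp_all add: x_def y_def z_def a_def b_def c_def h_def diag_coeff_eq)
    have neq: "b - a \<noteq> 0" "c - a \<noteq> 0" "c - b \<noteq> 0"
      using True assms by (auto simp: generic_pair_def a_def b_def c_def)
    \<comment> \<open>Clearing the three denominators leaves \<open>x\<close>, \<open>y\<close>,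
      \<open>z\<close> only in the products evaluated by \<open>eqs\<close>.\<close>
    have "(x * z + y * (h - x) - z * y) * ((b - a) * (c - a) * (c - b)) =
        (x * (b - a)) * (z * (c - b)) * (c - a) + (y * (c - a)) * h * (b - a) * (c - b)
        - (y * (c - a)) * (x * (b - a)) * (c - b) - (z * (c - b)) * (y * (c - a)) * (b - a)"
      by Groebner_Basis.algebra
    also have "\<dots> = 0"
      unfolding eqs by Groebner_Basis.algebra
    finally have P: "x * z + y * (h - x) = z * y"
      using neq by simp
    then have Q: "x * y = z * x + y * (h - z)"
      by Groebner_Basis.algebra
    \<comment> \<open>The two sides differ by
      \<open>(x - z) * (x * z + y * h - x * y - z * y)\<close>, and \<open>P\<close> makes the
      second factor 0.\<close>
    have R: "x ^ 2 * z + (1 + h * x - x ^ 2) * y = z ^ 2 * x + (1 + h * z - z ^ 2) * y"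
      using P by Groebner_Basis.algebra
    have "diag_coeff \<theta>' \<theta> = h - x" "diag_coeff \<theta>'' \<theta>' = h - z"
      using True diag_coeff_commute[OF assms(1)] diag_coeff_commute[OF assms(3)]
      by (simp_all add: x_def z_def h_def)
    with P Q R show ?thesis
      by (simp only: swap_coeff_mult[OF assms(1)] swap_coeff_mult[OF assms(3)]
          flip: x_def y_def z_def h_def)
  next
    case False
    \<comment> \<open>At most one of the three pairs has equal positions, so at most one diagonal
      coefficient is nonzero up to order. Products over different pairs vanish, and
      \<open>?R\<close> keeps only the coefficient of the outer pair, on both sides.\<close>
    then show ?thesis
      unfolding swap_coeff_mult[OF assms(1)] swap_coeff_mult[OF assms(3)]
      by (auto simp: diag_coeff_def)
  qed
  then show ?P ?Q ?R
    by blast+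
qed

text \<open>These are the entries of \<open>g\<^sub>1 X\<^sub>1 g\<^sub>1\<close> on a tableau
  vector: the off-diagonal one, without its swap coefficient, vanishes, and the diagonal one is the
  content of the second node.\<close>

lemma diag_coeff_qcontent:
  assumes "generic_pair \<theta> \<theta>'"
  shows "qcontent \<theta> * diag_coeff \<theta> \<theta>' + qcontent \<theta>' * diag_coeff \<theta>' \<theta> = 0" (is ?P)
    and "qcontent \<theta> * diag_coeff \<theta> \<theta>' ^ 2 + qcontent \<theta>' * (swap_coeff \<theta> \<theta>' * swap_coeff \<theta>' \<theta>) =
      qcontent \<theta>'" (is ?Q)
proof -
  have "?P \<and> ?Q"
  proof (cases "node_pos \<theta> = node_pos \<theta>'")
    case True
    define h c c' x where "h = qF - inverse qF" and "c = qcontent \<theta>" and "c' = qcontent \<theta>'"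
      and "x = diag_coeff \<theta> \<theta>'"
    have "x * (c' - c) = c' * h"
      using diag_coeff_eq[OF assms True] by (simp add: x_def c_def c'_def h_def)
    then have "c * x + c' * (h - x) = 0" "c * x ^ 2 + c' * (1 + h * x - x ^ 2) = c'"
      by Groebner_Basis.algebra+
    then show ?thesis
      by (simp only: swap_coeff_mult[OF assms] diag_coeff_commute[OF assms True]
          flip: h_def c_def c'_def x_def)
  next
    case False
    then show ?thesis
      unfolding swap_coeff_mult[OF assms] by (simp add: diag_coeff_def)
  qed
  then show ?P ?Q
    by blast+
qed

section \<open>Operators of the generators\<close>

abbreviation tableau_vec :: "dm_tableau \<Rightarrow> dm_tableau \<Rightarrow>\<^sub>0 laurent fract" where
  "tableau_vec T \<equiv> Poly_Mapping.single T 1"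

text \<open>Both cases of the formula for \<open>g\<^sub>i\<close> are merged, with diagonal
  coefficient 0 and swap coefficient 1 at different positions. \<open>T\<close> is arbitrary and
  \<open>tableau_vec\<close> is never 0, in contrast to \<open>basis_vec\<close>.\<close>

fun gen_basis_action :: "(nat \<Rightarrow> complex) \<Rightarrow> gen \<Rightarrow> dm_tableau \<Rightarrow> dm_tableau \<Rightarrow>\<^sub>0 laurent fract" where
  "gen_basis_action \<xi> (gen_t j) T = scale (fract_of (laurent_const (\<xi> (node_pos (T j))))) (tableau_vec T)"
| "gen_basis_action \<xi> (gen_g i) T =
     scale (diag_coeff (T i) (T (Suc i))) (tableau_vec T) +
     scale (swap_coeff (T i) (T (Suc i))) (tableau_vec (swap_entries i T))"
| "gen_basis_action \<xi> gen_X T = scale (qcontent (T 1)) (tableau_vec T)"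
| "gen_basis_action \<xi> gen_X_inv T = scale (inverse (qcontent (T 1))) (tableau_vec T)"

definition gen_action ::
    "(nat \<Rightarrow> complex) \<Rightarrow> gen \<Rightarrow> (dm_tableau \<Rightarrow>\<^sub>0 laurent fract) \<Rightarrow> dm_tableau \<Rightarrow>\<^sub>0 laurent fract" where
  "gen_action \<xi> g = lin_ext (gen_basis_action \<xi> g)"

lemma gen_action_tableau_vec [simp]: "gen_action \<xi> g (tableau_vec T) = gen_basis_action \<xi> g T"
  by (simp add: gen_action_def)

lemma linear_op_gen_action: "linear_op (gen_action \<xi> g)"
  by (simp add: gen_action_def linear_op_lin_ext)

lemmas gen_action_linear [simp] =
  linear_op_add[OF linear_op_gen_action] linear_op_scale[OF linear_op_gen_action]

lemmas eval_free_gen_action [simp] =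
  fract_of.eval_free_mult[OF linear_op_gen_action]
  linear_op_add[OF fract_of.linear_op_eval_free[OF linear_op_gen_action]]
  linear_op_scale[OF fract_of.linear_op_eval_free[OF linear_op_gen_action]]

context standard_tableau
begin

lemma swap_entries_standard_iff:
  assumes "i \<in> {1..<n}"
  shows "swap_entries i T \<in> standard_tableaux n \<Lambda> \<longleftrightarrow> \<not> adjacent (T i) (T (Suc i))"
  using swap_standard_iff[OF assms] by (simp add: swap_entries_def)

lemma generic_pair_entries:
  assumes "i \<in> {1..n}" "j \<in> {1..n}" "i < j" "j \<le> i + 2"
  shows "generic_pair (T i) (T j)"
  using qcontent_neq[OF assms] by (simp add: generic_pair_def)

lemma qcontent_entry_mem:
  assumes "i \<in> {1..n}"
  shows "qcontent (T i) \<in> carrier (F_ring m)"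
proof -
  obtain x y k l where Ti: "T i = ((x, y), k, l)"
    by (metis surj_pair)
  then have "l \<le> m"
    using dm_nodes_bounds(2)[OF \<Lambda>] entry_node[OF assms] by fastforce
  then show ?thesis
    unfolding Ti by (rule qcontent_mem)
qed

lemma gen_basis_action_closed:
  assumes "g \<in> Y_gens n" "1 \<le> n"
  shows "gen_basis_action \<xi> g T \<in> carrier (V_module m n \<Lambda>)"
proof -
  let ?M = "free_module (carrier (F_ring m)) (standard_tableaux n \<Lambda>)"
  have vec: "scale c (tableau_vec T') \<in> carrier ?M"
    if "c \<in> carrier (F_ring m)" "T' \<in> standard_tableaux n \<Lambda>" for c T'
    using that F.one_mem by (intro F.free_module_scale_closed F.free_module_single_closed)
  have "gen_basis_action \<xi> g T \<in> carrier ?M"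
  proof (cases g)
    case (gen_t j)
    then show ?thesis
      using T by (simp add: vec fract_of_mem laurent_const_mem)
  next
    case (gen_g i)
    with assms have i: "i \<in> {1..<n}"
      by (auto simp: Y_gens_def)
    then have mem: "qcontent (T i) \<in> carrier (F_ring m)" "qcontent (T (Suc i)) \<in> carrier (F_ring m)"
      "inverse qF \<in> carrier (F_ring m)"
      by (simp_all add: qcontent_entry_mem F_ring_inverse_mem qF_mem)
    then have "diag_coeff (T i) (T (Suc i)) \<in> carrier (F_ring m)"
      "swap_coeff (T i) (T (Suc i)) \<in> carrier (F_ring m)"
      by (auto simp: diag_coeff_def swap_coeff_def F.zero_mem F.one_mem
          intro!: F_ring_divide_mem F_ring_diff_mem F.mult_mem qF_mem)
    \<comment> \<open>If the swap leaves the standard tableaux, the two nodes are adjacent. Adjacent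
      nodes have the same position, so the value 1 for different positions is excluded.\<close>
    moreover have "swap_coeff (T i) (T (Suc i)) = 0" if "swap_entries i T \<notin> standard_tableaux n \<Lambda>"
      using that swap_entries_standard_iff[OF i] by (simp add: swap_coeff_def adjacent_node_pos)
    ultimately show ?thesis
      using T by (cases "swap_entries i T \<in> standard_tableaux n \<Lambda>")
        (auto simp: gen_g intro!: F.free_module_add_closed vec)
  next
    case gen_X
    then show ?thesis
      using T qcontent_entry_mem[of 1] assms(2) by (simp add: vec)
  next
    case gen_X_inv
    then show ?thesis
      using T qcontent_entry_mem[of 1] assms(2) by (simp add: vec F_ring_inverse_mem)
  qed
  then show ?thesis
    by (simp add: V_module_def)
qed

end

section \<open>Verification of the defining relations\<close>

lemma gen_action_braid:
  assumes "generic_pair (T i) (T (Suc i))" "generic_pair (T i) (T (Suc (Suc i)))"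
    "generic_pair (T (Suc i)) (T (Suc (Suc i)))"
  shows "gen_action \<xi> (gen_g i) (gen_action \<xi> (gen_g (Suc i)) (gen_action \<xi> (gen_g i) (tableau_vec T))) =
    gen_action \<xi> (gen_g (Suc i)) (gen_action \<xi> (gen_g i) (gen_action \<xi> (gen_g (Suc i)) (tableau_vec T)))"
  \<comment> \<open>Six tableau vectors occur once \<open>swap_entries_braid\<close> has merged the
    two triple swaps. Their values at a key are treated as unknowns, which leaves a polynomial
    identity.\<close>
  by (simp add: scale_add_right swap_entries_braid, rule poly_mapping_eqI,
      simp only: lookup_add lookup_scale,
      use diag_coeff_braid[OF assms] in \<open>Groebner_Basis.algebra\<close>)

text \<open>\<open>g\<^sub>1 X\<^sub>1 g\<^sub>1\<close> is the Jucys-Murphy element attached to the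
  entry 2. Since it is diagonal in the tableau basis, it commutes with \<open>X\<^sub>1\<close>,
  which is the relation wanted.\<close>

lemma gen_action_X_braid:
  assumes "generic_pair (T 1) (T (Suc 1))"
  shows "gen_action \<xi> (gen_g 1) (gen_action \<xi> gen_X (gen_action \<xi> (gen_g 1) (tableau_vec T))) =
    scale (qcontent (T 2)) (tableau_vec T)"
  by (simp add: scale_add_right numeral_2_eq_2, rule poly_mapping_eqI,
      simp only: lookup_add lookup_scale One_nat_def[symmetric],
      use diag_coeff_qcontent[OF assms] in \<open>Groebner_Basis.algebra\<close>)

text \<open>The conditional is the effect of \<open>e_elem\<close> on this vector, as a swap does
  not change whether the two positions agree. For equal positions the formula is Cayley-Hamilton
  with trace \<open>q - 1/q\<close> and determinant -1; for different positions
  \<open>g\<^sub>i\<close> is a plain swap.\<close>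

lemma gen_action_square:
  assumes "generic_pair (T i) (T (Suc i))"
  shows "gen_action \<xi> (gen_g i) (gen_action \<xi> (gen_g i) (tableau_vec T)) =
     tableau_vec T + scale (qF - inverse qF)
       (if node_pos (T i) = node_pos (T (Suc i)) then gen_action \<xi> (gen_g i) (tableau_vec T) else 0)"
proof (cases "node_pos (T i) = node_pos (T (Suc i))")
  case True
  show ?thesis
    unfolding if_P[OF True]
    by (simp add: scale_add_right, rule poly_mapping_eqI, simp only: lookup_add lookup_scale,
        use diag_coeff_commute[OF assms True] swap_coeff_mult[OF assms]
        in \<open>Groebner_Basis.algebra\<close>)
next
  case False
  then show ?thesis
    using swap_coeff_mult[OF assms] by (simp add: scale_add_right diag_coeff_def)
qed

text \<open>Orthogonality of characters of a cyclic group of order \<open>d\<close>, with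
  \<open>b ^ (d - s)\<close> in the role of the inverse of \<open>b ^ s\<close>. For distinct roots
  the sum is a multiple of a geometric sum whose product with \<open>a - b\<close> is
  \<open>a ^ d - b ^ d = 0\<close>.\<close>

lemma sum_roots_of_unity:
  fixes a b :: complex
  assumes "0 < d" "a ^ d = 1" "b ^ d = 1"
  shows "1 / of_nat d * (\<Sum>s<d. a ^ s * b ^ (d - s)) = (if a = b then 1 else 0)"
proof (cases "a = b")
  case True
  then have "a ^ s * b ^ (d - s) = 1" if "s < d" for s
    using that assms(2) by (simp flip: power_add)
  with True assms(1) show ?thesis
    by simp
next
  case False
  \<comment> \<open>One factor \<open>b\<close> is split off, which \<open>s < d\<close> permits, to
    reach the exponents in the factorisation of \<open>a ^ d - b ^ d\<close>.\<close>
  have "(\<Sum>s<d. a ^ s * b ^ (d - s)) = b * (\<Sum>s<d. b ^ (d - Suc s) * a ^ s)"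
    unfolding sum_distrib_left
  proof (rule sum.cong)
    fix s assume "s \<in> {..<d}"
    then have "b ^ (d - s) = b * b ^ (d - Suc s)"
      by (simp add: Suc_diff_Suc flip: power_Suc)
    then show "a ^ s * b ^ (d - s) = b * (b ^ (d - Suc s) * a ^ s)"
      by simp
  qed simp
  moreover have "(a - b) * (\<Sum>s<d. b ^ (d - Suc s) * a ^ s) = 0"
    using assms(2,3) power_diff_sumr2[of a d b] by simp
  ultimately show ?thesis
    using False by simp
qed

lemma eval_t_power:
  "fract_of.eval_free (gen_action \<xi>) (tt j ^ s) (tableau_vec T) =
     scale (fract_of (laurent_const (\<xi> (node_pos (T j)) ^ s))) (tableau_vec T)"
  by (induction s) (simp_all add: const.hom_one const.hom_mult mult.commute)

text \<open>The generators \<open>t\<^sub>j\<close> are diagonal, so \<open>e_elem\<close> is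
  diagonal with a character sum as eigenvalue: it projects onto the tableaux where the two roots
  agree.\<close>

lemma eval_e_elem:
  assumes "0 < d" "\<xi> (node_pos (T i)) ^ d = 1" "\<xi> (node_pos (T (Suc i))) ^ d = 1"
  shows "fract_of.eval_free (gen_action \<xi>) (e_elem d i) (tableau_vec T) =
    (if \<xi> (node_pos (T i)) = \<xi> (node_pos (T (Suc i))) then tableau_vec T else 0)"
proof -
  let ?a = "\<xi> (node_pos (T i))" and ?b = "\<xi> (node_pos (T (Suc i)))"
  have scale_sum_left: "(\<Sum>s\<in>I. scale (c s) v) = scale (sum c I) v"
    for I :: "nat set" and c and v :: "dm_tableau \<Rightarrow>\<^sub>0 laurent fract"
    by (induction I rule: infinite_finite_induct) (simp_all add: scale_add_left)
  have "fract_of.eval_free (gen_action \<xi>) (e_elem d i) (tableau_vec T) =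
      scale (fract_of (laurent_const (1 / of_nat d * (\<Sum>s<d. ?a ^ s * ?b ^ (d - s))))) (tableau_vec T)"
    unfolding const.hom_mult const_sum
    by (simp add: e_elem_def fract_of.eval_free_scalar fract_of.eval_free_sum eval_t_power
        scale_sum_left mult.commute)
  then show ?thesis
    unfolding sum_roots_of_unity[OF assms] by (simp add: const.hom_one const.hom_zero)
qed

lemma eval_cyclotomic:
  "fract_of.eval_free (gen_action \<xi>) (prod_list (map (\<lambda>l. XX - scalar (indet_powi l 1)) ls)) (tableau_vec T) =
     scale (\<Prod>l\<leftarrow>ls. qcontent (T 1) - vF l) (tableau_vec T)"
proof (induction ls)
  case (Cons l ls)
  have "scale c v - scale c' v = scale (c - c') v" for c c' and v :: "dm_tableau \<Rightarrow>\<^sub>0 laurent fract"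
    using scale_add_left[of c "- c'" v] by (simp add: scale_minus_left)
  with Cons show ?case
    by (simp add: fract_of.eval_free_diff fract_of.eval_free_scalar vF_def mult.commute)
qed simp

lemma Y_gens_mem:
  "j \<in> {1..n} \<Longrightarrow> gen_t j \<in> Y_gens n" "i \<in> {1..<n} \<Longrightarrow> gen_g i \<in> Y_gens n"
  "gen_X \<in> Y_gens n" "gen_X_inv \<in> Y_gens n"
  by (simp_all add: Y_gens_def)

text \<open>The ideal generated by the relators is under control only if they lie in the carrier.
  This is where transposed indices must stay in \<open>{1..n}\<close> and indeterminates must have
  index at most \<open>m\<close>.\<close>

lemma Y_rel_closed:
  assumes "Y_rel d m n a b"
  shows "a \<in> carrier (Y_free m n) \<and> b \<in> carrier (Y_free m n)"
proof -
  have transpose_mem: "Transposition.transpose i (Suc i) j \<in> {1..n}"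
    if "i \<in> {1..<n}" "j \<in> {1..n}" for i j
    using that by (auto simp: transpose_def)
  have zero: "0 \<in> carrier (Y_free m n)"
    using R.free_algebra_diff_closed[OF R.one_free_algebra_closed R.one_free_algebra_closed]
    by (simp add: Y_free_def)
  have e: "e_elem d i \<in> carrier (Y_free m n)" if "i \<in> {1..<n}" for i
    unfolding Y_free_def e_elem_def using that
    by (intro R.free_algebra_closed_intros laurent_const_mem Y_gens_mem) simp_all
  have cyclotomic: "prod_list (map (\<lambda>l. XX - scalar (indet_powi l 1)) [1..<Suc m]) \<in> carrier (Y_free m n)"
    unfolding Y_free_def
    by (auto intro!: R.free_algebra_closed_intros Y_gens_mem indet_powi_mem simp del: upt_Suc)
  show ?thesis
    using assms
  proof cases
    case (t_g j i)
    then show ?thesis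
      using transpose_mem[of i j] unfolding t_g(1,2) Y_free_def
      by (intro conjI R.free_algebra_closed_intros Y_gens_mem) simp_all
  next
    case (g_square i)
    have "indet_powi 0 1 - indet_powi 0 (- 1) \<in> carrier (R_ring m)"
      using R.add_mem[OF indet_powi_mem R.uminus_mem[OF indet_powi_mem], of 0 m 0 1 "- 1"] by simp
    then show ?thesis
      using g_square(3) e[of i] unfolding g_square(1,2) Y_free_def
      by (intro conjI R.free_algebra_closed_intros Y_gens_mem)
  next
    case X_cyclotomic
    then show ?thesis
      using zero cyclotomic by simp
  qed (auto simp: Y_free_def intro!: R.free_algebra_closed_intros Y_gens_mem)
qed

context standard_tableau
begin

lemma gen_action_relation:
  assumes "Y_rel d m n a b" "0 < d" "0 < n" and \<xi>: "bij_betw \<xi> {1..d} {z. z ^ d = 1}"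
  shows "fract_of.eval_free (gen_action \<xi>) a (tableau_vec T) =
    fract_of.eval_free (gen_action \<xi>) b (tableau_vec T)"
proof -
  have pos: "node_pos (T i) \<in> {1..d}" if "i \<in> {1..n}" for i
  proof -
    obtain x y k l where "T i = ((x, y), k, l)"
      by (metis surj_pair)
    then show ?thesis
      using dm_nodes_bounds(1)[OF \<Lambda>, of x y k l] entry_node[OF that] by simp
  qed
  have root: "\<xi> (node_pos (T i)) ^ d = 1" if "i \<in> {1..n}" for i
    using pos[OF that] bij_betwE[OF \<xi>] by blast
  \<comment> \<open>\<open>e_elem\<close> tests equality of roots of unity, the formulas test
    equality of positions; injectivity of \<xi> identifies the two tests.\<close>
  have \<xi>_eq: "\<xi> (node_pos (T i)) = \<xi> (node_pos (T j)) \<longleftrightarrow> node_pos (T i) = node_pos (T j)"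
    if "i \<in> {1..n}" "j \<in> {1..n}" for i j
    using pos that bij_betw_imp_inj_on[OF \<xi>] by (simp add: inj_on_eq_iff)
  from assms(1) show ?thesis
  proof cases
    case (g_comm i j)
    \<comment> \<open>These inequalities ensure that each swap leaves alone the nodes on which the
      other coefficients depend.\<close>
    then have "j \<noteq> i" "j \<noteq> Suc i" "Suc j \<noteq> i" "Suc j \<noteq> Suc i"
      by auto
    then show ?thesis
      using g_comm swap_entries_commute[of i j T]
      by (simp add: scale_add_right ac_simps)
  next
    case (g_braid i)
    then have "i \<in> {1..n}" "Suc i \<in> {1..n}" "Suc (Suc i) \<in> {1..n}"
      by auto
    with g_braid show ?thesis
      using gen_action_braid[of T i \<xi>] generic_pair_entries by simp
  next
    case (t_comm i j)
    then show ?thesis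
      by (simp add: mult.commute)
  next
    case (t_g j i)
    \<comment> \<open>On the diagonal term the two sides multiply by the roots at \<open>i\<close>
      and at \<open>i + 1\<close> in exchanged order; this is harmless because the term is 0 unless
      the roots agree.\<close>
    have "diag_coeff (T i) (T (Suc i)) = 0 \<or> node_pos (T i) = node_pos (T (Suc i))"
      by (simp add: diag_coeff_def)
    then show ?thesis
      using t_g by (cases "j = i"; cases "j = Suc i") (auto simp: scale_add_right mult.commute)
  next
    case (t_power j)
    then show ?thesis
      by (simp add: eval_t_power root const.hom_one)
  next
    case (g_square i)
    then have i: "i \<in> {1..n}" "Suc i \<in> {1..n}"
      by auto
    \<comment> \<open>The vector is a combination of \<open>T\<close> and its swap, on which
      \<open>e_elem\<close> acts by the same scalar, since the condition is symmetric in the two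
      entries.\<close>
    have e: "fract_of.eval_free (gen_action \<xi>) (e_elem d i) (gen_action \<xi> (gen_g i) (tableau_vec T)) =
      (if node_pos (T i) = node_pos (T (Suc i)) then gen_action \<xi> (gen_g i) (tableau_vec T) else 0)"
      using eval_e_elem[of d \<xi> T i] eval_e_elem[of d \<xi> "swap_entries i T" i] i assms(2) root
      by (simp add: \<xi>_eq diag_coeff_def)
    show ?thesis
      using gen_action_square[of T i \<xi>] generic_pair_entries[of i "Suc i"] i e
      unfolding g_square(1,2) power2_eq_square
      by (simp add: fract_of.eval_free_add fract_of.eval_free_scalar qF_minus_inverse
          del: gen_action_tableau_vec)
  next
    case X_g_braid
    then have "generic_pair (T 1) (T (Suc 1))"
      using generic_pair_entries[of 1 "Suc 1"] by simp
    \<comment> \<open>With one factor \<open>X\<^sub>1\<close> split off on the left or on the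
      right, both sides multiply by the contents of the entries 1 and 2.\<close>
    note gXg = gen_action_X_braid[OF this, unfolded One_nat_def]
    have "gen_action \<xi> gen_X (tableau_vec T) = scale (qcontent (T 1)) (tableau_vec T)"
      by simp
    then show ?thesis
      unfolding X_g_braid(1,2)
      by (simp add: gXg mult.commute del: gen_action_tableau_vec)
  next
    case (X_g_comm i)
    then show ?thesis
      by (simp add: scale_add_right mult.commute)
  next
    case (X_t_comm j)
    then show ?thesis
      by (simp add: mult.commute)
  next
    case X_cyclotomic
    obtain k l where "T 1 = ((1, 1), k, l)" "l \<in> {1..m}"
      using first_node assms(3) by auto
    \<comment> \<open>In node (1, 1) the exponent of \<open>q\<close> is 0, so the factor of index
      \<open>l\<close> vanishes.\<close>
    then have "qcontent (T 1) = vF l" "l \<in> set [1..<Suc m]"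
      by auto
    then have "(\<Prod>l\<leftarrow>[1..<Suc m]. qcontent (T 1) - vF l) = 0"
      by (force simp: prod_list_zero_iff simp del: upt_Suc)
    then show ?thesis
      unfolding X_cyclotomic eval_cyclotomic by (simp add: fract_of.eval_free_zero)
  next
    case X_inv_right
    then show ?thesis
      by (simp add: qcontent_nonzero)
  next
    case X_inv_left
    then show ?thesis
      by (simp add: qcontent_nonzero)
  qed
qed

end

theorem proposition3p2:
  fixes d m n :: nat
    and \<xi> :: "nat \<Rightarrow> complex"
    and \<Lambda> :: "nat list list list"
  assumes "0 < d" and "0 < m" and "0 < n"
    and "bij_betw \<xi> {1..d} {z. z ^ d = 1}"
    and "\<Lambda> \<in> dm_partitions d m n"
  shows "\<exists>\<rho> \<in> representations (F_ring m) (FY_algebra d m n) (V_module m n \<Lambda>).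
    \<forall>T \<in> standard_tableaux n \<Lambda>.
      \<rho> (FY_gen d m n gen_X) (basis_vec n \<Lambda> T) = qcontent (T 1) \<odot>\<^bsub>V_module m n \<Lambda>\<^esub> basis_vec n \<Lambda> T \<and>
      (\<forall>j \<in> {1..n}. \<rho> (FY_gen d m n (gen_t j)) (basis_vec n \<Lambda> T) =
         fract_of (laurent_const (\<xi> (node_pos (T j)))) \<odot>\<^bsub>V_module m n \<Lambda>\<^esub> basis_vec n \<Lambda> T) \<and>
      (\<forall>i \<in> {1..n - 1}.
         (node_pos (T i) \<noteq> node_pos (T (i + 1)) \<longrightarrow>
            \<rho> (FY_gen d m n (gen_g i)) (basis_vec n \<Lambda> T) =
              basis_vec n \<Lambda> (apply_entries (Transposition.transpose i (i + 1)) T)) \<and>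
         (node_pos (T i) = node_pos (T (i + 1)) \<longrightarrow>
            \<rho> (FY_gen d m n (gen_g i)) (basis_vec n \<Lambda> T) =
              (qcontent (T (i + 1)) * (qF - inverse qF) / (qcontent (T (i + 1)) - qcontent (T i)))
                \<odot>\<^bsub>V_module m n \<Lambda>\<^esub> basis_vec n \<Lambda> T
              \<oplus>\<^bsub>V_module m n \<Lambda>\<^esub>
              ((qF * qcontent (T (i + 1)) - inverse qF * qcontent (T i)) / (qcontent (T (i + 1)) - qcontent (T i)))
                \<odot>\<^bsub>V_module m n \<Lambda>\<^esub> basis_vec n \<Lambda> (apply_entries (Transposition.transpose i (i + 1)) T)))"
proof -
  note \<Lambda> = assms(5)
  have tableau: "standard_tableau d m n \<Lambda> T" if "T \<in> standard_tableaux n \<Lambda>" for T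
    using \<Lambda> that by unfold_locales
  let ?M = "free_module (carrier (F_ring m)) (standard_tableaux n \<Lambda>)"
  let ?A = "free_algebra (carrier (R_ring m)) (Y_gens n)"
  let ?U = "{a - b | a b. Y_rel d m n a b}"
  have "\<exists>\<rho> \<in> representations (ring_on (carrier (F_ring m)))
      (base_change (ring_on (carrier (R_ring m))) fract_of (ring_on (carrier (F_ring m)))
        (quotient_algebra ?A (genideal ?A ?U))) ?M.
    \<forall>g \<in> Y_gens n. \<forall>v \<in> carrier ?M.
      \<rho> (pure_tensor (ring_on (carrier (R_ring m))) fract_of (ring_on (carrier (F_ring m)))
        (quotient_algebra ?A (genideal ?A ?U)) 1 (genideal ?A ?U +>\<^bsub>?A\<^esub> letter g)) v =
      gen_action \<xi> g v"
  proof (rule RF.presented_algebra_representation)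
    show "linear_op (gen_action \<xi> g)" for g
      by (rule linear_op_gen_action)
    show "gen_action \<xi> g v \<in> carrier ?M" if "g \<in> Y_gens n" "v \<in> carrier ?M" for g v
      unfolding gen_action_def
    proof (rule F.lin_ext_closed[OF that(2)])
      show "gen_basis_action \<xi> g T \<in> carrier ?M" if "T \<in> standard_tableaux n \<Lambda>" for T
        using standard_tableau.gen_basis_action_closed[OF tableau[OF that] \<open>g \<in> Y_gens n\<close>] assms(3)
        by (simp add: V_module_def)
    qed
    show "?U \<subseteq> carrier ?A"
      using Y_rel_closed by (auto simp: Y_free_def intro!: R.free_algebra_diff_closed)
    show "fract_of.eval_free (gen_action \<xi>) u v = 0" if "u \<in> ?U" and v: "v \<in> carrier ?M" for u v
    proof -
      from \<open>u \<in> ?U\<close> obtain a b where u: "u = a - b" "Y_rel d m n a b"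
        by blast
      have "fract_of.eval_free (gen_action \<xi>) a v = fract_of.eval_free (gen_action \<xi>) b v"
      proof (rule linear_op_eqI[where f = "fract_of.eval_free (gen_action \<xi>) a"
            and g = "fract_of.eval_free (gen_action \<xi>) b" and S = "standard_tableaux n \<Lambda>"])
        show "linear_op (fract_of.eval_free (gen_action \<xi>) a)"
          "linear_op (fract_of.eval_free (gen_action \<xi>) b)"
          by (rule fract_of.linear_op_eval_free[OF linear_op_gen_action])+
        show "Poly_Mapping.keys v \<subseteq> standard_tableaux n \<Lambda>"
          using v by (simp add: F.free_module_simps)
        show "fract_of.eval_free (gen_action \<xi>) a (tableau_vec T) =
            fract_of.eval_free (gen_action \<xi>) b (tableau_vec T)" if "T \<in> standard_tableaux n \<Lambda>" for T
          using standard_tableau.gen_action_relation[OF tableau[OF that] u(2) assms(1,3,4)] .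
      qed
      then show ?thesis
        by (simp add: u(1) fract_of.eval_free_diff)
    qed
  qed
  \<comment> \<open>Apart from unfolding, this uses only that \<open>R_ring m\<close> and
    \<open>F_ring m\<close> are recovered from their carriers by \<open>ring_on\<close>.\<close>
  then have "\<exists>\<rho> \<in> representations (F_ring m) (FY_algebra d m n) (V_module m n \<Lambda>).
    \<forall>g \<in> Y_gens n. \<forall>v \<in> carrier ?M. \<rho> (FY_gen d m n g) v = gen_action \<xi> g v"
    unfolding ring_on_R_ring ring_on_F_ring FY_algebra_def FY_gen_def Y_algebra_def Y_ideal_def
      Y_free_def V_module_def .
  then obtain \<rho> where \<rho>: "\<rho> \<in> representations (F_ring m) (FY_algebra d m n) (V_module m n \<Lambda>)"
    and \<rho>_gen: "\<And>g v. g \<in> Y_gens n \<Longrightarrow> v \<in> carrier ?M \<Longrightarrow> \<rho> (FY_gen d m n g) v = gen_action \<xi> g v"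
    by blast
  show ?thesis
  proof (intro bexI[OF _ \<rho>] ballI)
    fix T assume T: "T \<in> standard_tableaux n \<Lambda>"
    interpret standard_tableau d m n \<Lambda> T
      using T by (rule tableau)
    have vec: "tableau_vec T \<in> carrier ?M"
      using T F.one_mem by (intro F.free_module_single_closed)
    have basis: "basis_vec n \<Lambda> T = tableau_vec T"
      using T by (simp add: basis_vec_def)
    \<comment> \<open>Two conventions meet here: for adjacent nodes \<open>swap_coeff\<close> is 0
      on the left, while on the right the coefficient keeps the given formula and
      \<open>basis_vec\<close> is 0, the swap being non-standard.\<close>
    have swap: "scale (swap_coeff (T i) (T (Suc i))) (tableau_vec (swap_entries i T)) =
        scale (if node_pos (T i) = node_pos (T (Suc i))
          then (qF * qcontent (T (Suc i)) - inverse qF * qcontent (T i)) / (qcontent (T (Suc i)) - qcontent (T i))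
          else 1) (basis_vec n \<Lambda> (swap_entries i T))"
      if "i \<in> {1..<n}" for i
      using swap_entries_standard_iff[OF that] adjacent_node_pos[of "T i" "T (Suc i)"]
      by (simp add: swap_coeff_def basis_vec_def)
    have g: "\<rho> (FY_gen d m n (gen_g i)) (basis_vec n \<Lambda> T) =
        scale (diag_coeff (T i) (T (Suc i))) (basis_vec n \<Lambda> T) +
        scale (if node_pos (T i) = node_pos (T (Suc i))
          then (qF * qcontent (T (Suc i)) - inverse qF * qcontent (T i)) / (qcontent (T (Suc i)) - qcontent (T i))
          else 1) (basis_vec n \<Lambda> (swap_entries i T))" if "i \<in> {1..n - 1}" for i
    proof -
      from that have i: "i \<in> {1..<n}"
        by auto
      then show ?thesis
        unfolding basis by (simp only: \<rho>_gen[OF Y_gens_mem(2) vec] gen_action_tableau_vec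
            gen_basis_action.simps swap)
    qed
    show "\<rho> (FY_gen d m n gen_X) (basis_vec n \<Lambda> T) = qcontent (T 1) \<odot>\<^bsub>V_module m n \<Lambda>\<^esub> basis_vec n \<Lambda> T \<and>
      (\<forall>j \<in> {1..n}. \<rho> (FY_gen d m n (gen_t j)) (basis_vec n \<Lambda> T) =
         fract_of (laurent_const (\<xi> (node_pos (T j)))) \<odot>\<^bsub>V_module m n \<Lambda>\<^esub> basis_vec n \<Lambda> T) \<and>
      (\<forall>i \<in> {1..n - 1}.
         (node_pos (T i) \<noteq> node_pos (T (i + 1)) \<longrightarrow>
            \<rho> (FY_gen d m n (gen_g i)) (basis_vec n \<Lambda> T) =
              basis_vec n \<Lambda> (apply_entries (Transposition.transpose i (i + 1)) T)) \<and>
         (node_pos (T i) = node_pos (T (i + 1)) \<longrightarrow>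
            \<rho> (FY_gen d m n (gen_g i)) (basis_vec n \<Lambda> T) =
              (qcontent (T (i + 1)) * (qF - inverse qF) / (qcontent (T (i + 1)) - qcontent (T i)))
                \<odot>\<^bsub>V_module m n \<Lambda>\<^esub> basis_vec n \<Lambda> T
              \<oplus>\<^bsub>V_module m n \<Lambda>\<^esub>
              ((qF * qcontent (T (i + 1)) - inverse qF * qcontent (T i)) / (qcontent (T (i + 1)) - qcontent (T i)))
                \<odot>\<^bsub>V_module m n \<Lambda>\<^esub> basis_vec n \<Lambda> (apply_entries (Transposition.transpose i (i + 1)) T)))"
      unfolding apply_entries_transpose V_module_def F.free_module_simps
    proof (intro conjI ballI impI)
      show "\<rho> (FY_gen d m n gen_X) (basis_vec n \<Lambda> T) = scale (qcontent (T 1)) (basis_vec n \<Lambda> T)"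
        by (simp add: basis \<rho>_gen[OF Y_gens_mem(3) vec])
      show "\<rho> (FY_gen d m n (gen_t j)) (basis_vec n \<Lambda> T) =
          scale (fract_of (laurent_const (\<xi> (node_pos (T j))))) (basis_vec n \<Lambda> T)"
        if "j \<in> {1..n}" for j
        using that by (simp add: basis \<rho>_gen[OF Y_gens_mem(1) vec])
    qed (simp_all add: g diag_coeff_def)
  qed
qed

end
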